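(* The conjugate quandle $\mathrm{Conj}(\mathrm{PSL}(2,\mathbb{C}))$ is decomposed into connected components as $$\mathrm{Conj}(\mathrm{PSL}(2,\mathbb{C}))=\{\mathrm{id}\}\sqcup\Bigl(\bigsqcup_{\tau\in\mathcal{T}}\mathrm{Conj}(X_\tau)\Bigr).$$ Each connected component $\mathrm{Conj}(X_\tau)$ is (1) a $2$-dimensional complex manifold that is homeomorphic to $H_\tau\backslash\mathrm{PSL}(2,\mathbb{C})$, and (2) a connected subquandle of $\mathrm{Conj}(\mathrm{PSL}(2,\mathbb{C}))$ that is isomorphic to $Q(\mathrm{PSL}(2,\mathbb{C}),H_\tau,\sigma_\tau)$.
   Context: A quandle is a non-empty set $X$ with a binary operation $\lhd$ such that $x\lhd x=x$; for every $y$ the map $s_y(x)=x\lhd y$ is a bijection of $X$; and $(x\lhd y)\lhd z=(x\lhd z)\lhd(y\lhd z)$. Isomorphisms are bijections preserving $\lhd$. The inner automorphism group of $X$ is the group of bijections generated by all $s_y$; a connected component of $X$ is one of its orbits, and $X$ is connected if it acts transitively. A subquandle is a subset that is a quandle under the restricted operation. For a group $G$, $\mathrm{Conj}(G)$ is $G$ with $x\lhd y=y^{-1}xy$; for a conjugation-closed subset $Y\subset G$, $\mathrm{Conj}(Y)$ is the corresponding subquandle. A quandle triplet $(G,H,\sigma)$ consists of a group $G$, an automorphism $\sigma$ of $G$ and a subgroup $H$ of $\{g\in G\mid\sigma(g)=g\}$; $Q(G,H,\sigma)$ is the quandle $H\backslash G$ with $Hx\lhd Hy:=H\sigma(xy^{-1})y$.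 $\mathrm{PSL}(2,\mathbb{C})=\mathrm{SL}(2,\mathbb{C})/\{\pm I_2\}$ has the quotient topology; write $f_A$ for the class of $A$ and regard elements as linear fractional transformations: $S_\lambda(z)=\lambda z$, $S'_\lambda(z)=-\lambda/z$ ($\lambda\in\mathbb{C}^*$), $T_v(z)=z+v$ ($v\in\mathbb{C}$). Let $\mathcal{T}=\mathbb{C}/(z\sim-z)$, $[t]=\{\pm t\}$. For $\tau\in\mathcal{T}$: $X_\tau=\{f_A\in\mathrm{PSL}(2,\mathbb{C})\setminus\{\mathrm{id}\}\mid\operatorname{tr}A\in\tau\}$ with the relative topology; $f_{[2]}=T_1$ and $f_\tau=S_{\lambda_t^2}$ for $\tau=[t]\neq[2]$, where $\lambda_t=e^{i\theta}$ if $t=2\cos\theta\in(-2,2)$, $\theta\in(-\pi,\pi)$, and $\lambda_t=\lambda$ if $t=\lambda+\lambda^{-1}\in\mathbb{C}\setminus[-2,2]$ with $|\lambda|>1$ (any fixed choice of representative $t$ and of $\theta$); $H_{[2]}=\{T_v\mid v\in\mathbb{C}\}$, $H_\tau=\{S_\lambda\mid\lambda\in\mathbb{C}^*\}$ for $\tau\ne[0],[2]$, and $H_{[0]}=\{S_\lambda\mid\lambda\in\mathbb{C}^*\}\cup\{S'_\lambda\mid\lambda\in\mathbb{C}^*\}$. Let $\sigma_\tau(g)=f_\tau^{-1}gf_\tau$. The space $H_\tau\backslash\mathrm{PSL}(2,\mathbb C)$ of right cosets $H_\tau g$ has the quotient topology. *)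

theory Defs
  imports
    "HOL-Analysis.Analysis"
    "HOL-Computational_Algebra.Polynomial"
    "HOL-Algebra.Group_Action"
    "HOL-Algebra.Elementary_Groups"
begin

section \<open>Quandles\<close>

record 'a quandle = "'a partial_object" +
  qop :: "['a, 'a] \<Rightarrow> 'a"  (infixl \<open>\<triangleleft>\<index>\<close> 70)

text \<open>Closure of the carrier under the operation is part of \<open>bij\<close>.\<close>

locale quandle =
  fixes Q (structure)
  assumes nonempty: "carrier Q \<noteq> {}"
    and idem: "x \<in> carrier Q \<Longrightarrow> x \<triangleleft> x = x"
    and bij: "y \<in> carrier Q \<Longrightarrow> bij_betw (\<lambda>x. x \<triangleleft> y) (carrier Q) (carrier Q)"
    and distrib: "\<lbrakk>x \<in> carrier Q; y \<in> carrier Q; z \<in> carrier Q\<rbrakk>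
      \<Longrightarrow> (x \<triangleleft> y) \<triangleleft> z = (x \<triangleleft> z) \<triangleleft> (y \<triangleleft> z)"

definition quandle_isomorphic :: "('a, 'c) quandle_scheme \<Rightarrow> ('b, 'd) quandle_scheme \<Rightarrow> bool"
  where "quandle_isomorphic P Q \<longleftrightarrow>
    (\<exists>\<phi>. bij_betw \<phi> (carrier P) (carrier Q) \<and>
      (\<forall>x\<in>carrier P. \<forall>y\<in>carrier P. \<phi> (x \<triangleleft>\<^bsub>P\<^esub> y) = \<phi> x \<triangleleft>\<^bsub>Q\<^esub> \<phi> y))"

text \<open>Elements of \<open>BijGroup\<close> are extensional functions, hence the restricted abstraction
  in the generators \<open>s\<^sub>y\<close>.\<close>

definition Inn :: "('a, 'c) quandle_scheme \<Rightarrow> ('a \<Rightarrow> 'a) monoid"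
  where "Inn Q = subgroup_generated (BijGroup (carrier Q))
    ((\<lambda>y. \<lambda>x\<in>carrier Q. x \<triangleleft>\<^bsub>Q\<^esub> y) ` carrier Q)"

definition quandle_components :: "('a, 'c) quandle_scheme \<Rightarrow> 'a set set"
  where "quandle_components Q = orbits (Inn Q) (carrier Q) (\<lambda>f. f)"

definition connected_quandle :: "('a, 'c) quandle_scheme \<Rightarrow> bool"
  where "connected_quandle Q \<longleftrightarrow> quandle Q \<and>
    (\<forall>x\<in>carrier Q. \<forall>y\<in>carrier Q. \<exists>f\<in>carrier (Inn Q). f x = y)"

definition subquandle :: "'a set \<Rightarrow> ('a, 'c) quandle_scheme \<Rightarrow> bool"
  where "subquandle Y Q \<longleftrightarrow> Y \<subseteq> carrier Q \<and> quandle (Q\<lparr>carrier := Y\<rparr>)"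

text \<open>\<open>Conj_on G Y\<close> is $\mathrm{Conj}(Y)$ for a conjugation-closed subset \<open>Y\<close> of \<open>G\<close>.\<close>

definition Conj_on :: "('a, 'c) monoid_scheme \<Rightarrow> 'a set \<Rightarrow> 'a quandle"
  where "Conj_on G Y = \<lparr>carrier = Y, qop = (\<lambda>x y. inv\<^bsub>G\<^esub> y \<otimes>\<^bsub>G\<^esub> x \<otimes>\<^bsub>G\<^esub> y)\<rparr>"

abbreviation Conj :: "('a, 'c) monoid_scheme \<Rightarrow> 'a quandle"
  where "Conj G \<equiv> Conj_on G (carrier G)"

definition quandle_triplet :: "('a, 'c) monoid_scheme \<Rightarrow> 'a set \<Rightarrow> ('a \<Rightarrow> 'a) \<Rightarrow> bool"
  where "quandle_triplet G H \<sigma> \<longleftrightarrow>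
    group G \<and> \<sigma> \<in> iso G G \<and> subgroup H G \<and> H \<subseteq> {g \<in> carrier G. \<sigma> g = g}"

text \<open>The operation $Hx \lhd Hy = H\sigma(xy^{-1})y$ is written as a union over all
  representatives; for a quandle triplet all these cosets coincide, see
  \<open>triplet_quandle_op\<close> below.\<close>

definition triplet_quandle ::
    "('a, 'c) monoid_scheme \<Rightarrow> 'a set \<Rightarrow> ('a \<Rightarrow> 'a) \<Rightarrow> 'a set quandle"
  where "triplet_quandle G H \<sigma> =
    \<lparr>carrier = rcosets\<^bsub>G\<^esub> H,
     qop = (\<lambda>A B. \<Union>x\<in>A. \<Union>y\<in>B. H #>\<^bsub>G\<^esub> (\<sigma> (x \<otimes>\<^bsub>G\<^esub> inv\<^bsub>G\<^esub> y) \<otimes>\<^bsub>G\<^esub> y))\<rparr>"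

lemma triplet_quandle_op:
  fixes G (structure)
  assumes T: "quandle_triplet G H \<sigma>" and x: "x \<in> carrier G" and y: "y \<in> carrier G"
  shows "(H #> x) \<triangleleft>\<^bsub>triplet_quandle G H \<sigma>\<^esub> (H #> y) = H #> (\<sigma> (x \<otimes> inv y) \<otimes> y)"
proof -
  interpret group G using T by (simp add: quandle_triplet_def)
  have H: "subgroup H G" and fixH: "\<And>h. h \<in> H \<Longrightarrow> \<sigma> h = h" and hom: "\<sigma> \<in> hom G G"
    using T by (auto simp: quandle_triplet_def iso_def)
  interpret hm: group_hom G G \<sigma> by unfold_locales (rule hom)
  note Hc = subgroup.mem_carrier[OF H]
  have "H #> (\<sigma> (a \<otimes> inv b) \<otimes> b) = H #> (\<sigma> (x \<otimes> inv y) \<otimes> y)"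
    if a: "a \<in> H #> x" and b: "b \<in> H #> y" for a b
  proof -
    obtain h where h: "h \<in> H" "a = h \<otimes> x" using a by (auto simp: r_coset_def)
    obtain k where k: "k \<in> H" "b = k \<otimes> y" using b by (auto simp: r_coset_def)
    have hk: "h \<in> carrier G" "k \<in> carrier G" "inv k \<in> H" "inv k \<in> carrier G"
      using h k Hc subgroup.m_inv_closed[OF H] by auto
    have \<sigma>c: "\<sigma> (x \<otimes> inv y) \<in> carrier G" by (intro hm.hom_closed m_closed inv_closed x y)
    have "a \<otimes> inv b = h \<otimes> (x \<otimes> inv y) \<otimes> inv k"
      unfolding h(2) k(2) using hk x y by (simp add: inv_mult_group m_assoc)
    then have "\<sigma> (a \<otimes> inv b) = \<sigma> (h \<otimes> (x \<otimes> inv y)) \<otimes> \<sigma> (inv k)"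
      using hk x y hm.hom_mult[of "h \<otimes> (x \<otimes> inv y)" "inv k"] by (simp only: m_closed inv_closed)
    also have "\<dots> = h \<otimes> \<sigma> (x \<otimes> inv y) \<otimes> inv k"
      using h hk x y hm.hom_mult[of h "x \<otimes> inv y"] fixH by (simp only: m_closed inv_closed)
    finally have "\<sigma> (a \<otimes> inv b) \<otimes> b = h \<otimes> \<sigma> (x \<otimes> inv y) \<otimes> inv k \<otimes> (k \<otimes> y)"
      unfolding k(2) by (simp only:)
    also have "\<dots> = h \<otimes> (\<sigma> (x \<otimes> inv y) \<otimes> y)"
    proof -
      have "inv k \<otimes> (k \<otimes> y) = y" using hk y by (simp flip: m_assoc)
      then show ?thesis using hk y \<sigma>c by (simp only: m_assoc m_closed)
    qed
    finally have "H #> (\<sigma> (a \<otimes> inv b) \<otimes> b) = H #> h #> (\<sigma> (x \<otimes> inv y) \<otimes> y)"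
      using hk y \<sigma>c coset_mult_assoc[OF subgroup.subset[OF H]] by (simp only: m_closed)
    moreover have "H #> h = H" using coset_join2[OF hk(1) H h(1)] .
    ultimately show ?thesis by (simp only:)
  qed
  moreover have "x \<in> H #> x" "y \<in> H #> y" using rcos_self[OF _ H] x y by auto
  ultimately show ?thesis unfolding triplet_quandle_def quandle.simps by blast
qed


section \<open>Quotient topologies and complex manifolds\<close>

definition quotient_topology :: "'a topology \<Rightarrow> ('a \<Rightarrow> 'b) \<Rightarrow> 'b topology"
  where "quotient_topology X f = topology (\<lambda>U. U \<subseteq> f ` topspace X \<and> openin X {x \<in> topspace X. f x \<in> U})"

lemma openin_quotient_topology:
  "openin (quotient_topology X f) U \<longleftrightarrow>
    U \<subseteq> f ` topspace X \<and> openin X {x \<in> topspace X. f x \<in> U}"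
proof -
  have "istopology (\<lambda>U. U \<subseteq> f ` topspace X \<and> openin X {x \<in> topspace X. f x \<in> U})"
    unfolding istopology_def
  proof (intro conjI allI impI; (elim conjE)?)
    fix S T assume "openin X {x \<in> topspace X. f x \<in> S}" "openin X {x \<in> topspace X. f x \<in> T}"
    then have "openin X ({x \<in> topspace X. f x \<in> S} \<inter> {x \<in> topspace X. f x \<in> T})" by blast
    then show "openin X {x \<in> topspace X. f x \<in> S \<inter> T}"
      by (rule back_subst[of "openin X"]) blast
  next
    fix \<K> assume K: "\<forall>K\<in>\<K>. K \<subseteq> f ` topspace X \<and> openin X {x \<in> topspace X. f x \<in> K}"
    then have "openin X (\<Union>K\<in>\<K>. {x \<in> topspace X. f x \<in> K})" by blast
    then show "openin X {x \<in> topspace X. f x \<in> \<Union>\<K>}"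
      by (rule back_subst[of "openin X"]) blast
  qed blast+
  then show ?thesis by (simp add: quotient_topology_def)
qed

lemma quotient_map_quotient_topology: "quotient_map X (quotient_topology X f) f"
proof -
  have "openin (quotient_topology X f) (f ` topspace X)"
    by (auto simp: openin_quotient_topology intro: back_subst[of "openin X", OF openin_topspace])
  then have "topspace (quotient_topology X f) = f ` topspace X"
    by (meson openin_quotient_topology openin_subset openin_topspace subset_antisym)
  then show ?thesis by (auto simp: quotient_map_def openin_quotient_topology)
qed

text \<open>Holomorphy of maps between open subsets of $\mathbb{C}^n$ and $\mathbb{C}^m$: the
  (real) Fr\'echet derivative exists and is complex linear.\<close>

definition holomorphic_vec_on :: "(complex^'n \<Rightarrow> complex^'m) \<Rightarrow> (complex^'n) set \<Rightarrow> bool"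
  where "holomorphic_vec_on f S \<longleftrightarrow>
    (\<forall>x\<in>S. \<exists>D. (f has_derivative D) (at x) \<and> (\<forall>c v. D (c *s v) = c *s D v))"

definition complex_atlas :: "'a topology \<Rightarrow> ('a set \<times> ('a \<Rightarrow> complex^'n)) set \<Rightarrow> bool"
  where "complex_atlas X \<A> \<longleftrightarrow>
    (\<Union>(U, \<phi>)\<in>\<A>. U) = topspace X \<and>
    (\<forall>(U, \<phi>)\<in>\<A>. openin X U \<and> open (\<phi> ` U) \<and>
       homeomorphic_map (subtopology X U) (top_of_set (\<phi> ` U)) \<phi>) \<and>
    (\<forall>(U, \<phi>)\<in>\<A>. \<forall>(V, \<psi>)\<in>\<A>. holomorphic_vec_on (\<psi> \<circ> inv_into U \<phi>) (\<phi> ` (U \<inter> V)))"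

text \<open>A complex manifold of dimension \<open>CARD('n)\<close>.\<close>

definition complex_manifold :: "'n::finite itself \<Rightarrow> 'a topology \<Rightarrow> bool"
  where "complex_manifold _ X \<longleftrightarrow> Hausdorff_space X \<and> second_countable X \<and>
    (\<exists>\<A> :: ('a set \<times> ('a \<Rightarrow> complex^'n)) set. complex_atlas X \<A>)"


section \<open>The group $\mathrm{PSL}(2,\mathbb{C})$\<close>

definition SL2 :: "(complex^2^2) monoid"
  where "SL2 = \<lparr>carrier = {A. det A = 1}, mult = (**), one = mat 1\<rparr>"

definition PSL2 :: "(complex^2^2) set monoid"
  where "PSL2 = SL2 Mod {mat 1, - mat 1}"

text \<open>\<open>psl A\<close> is the class $f_A = \{A, -A\}$ of \<open>A\<close>.\<close>

definition psl :: "complex^2^2 \<Rightarrow> (complex^2^2) set"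
  where "psl A = {mat 1, - mat 1} #>\<^bsub>SL2\<^esub> A"

definition PSL2_topology :: "(complex^2^2) set topology"
  where "PSL2_topology = quotient_topology (top_of_set (carrier SL2)) psl"

text \<open>The set of all matrices in $\mathrm{SL}(2,\mathbb{C})$ whose linear fractional
  transformation is \<open>\<phi>\<close> (away from its pole). If there are any, they form one class
  $\{A,-A\}$, so this set is then the element of $\mathrm{PSL}(2,\mathbb{C})$ that is
  regarded as the transformation \<open>\<phi>\<close>.\<close>

definition lft_class :: "(complex \<Rightarrow> complex) \<Rightarrow> (complex^2^2) set"
  where "lft_class \<phi> = {A \<in> carrier SL2. \<forall>z. A$2$1 * z + A$2$2 \<noteq> 0 \<longrightarrow>
    moebius (A$1$1) (A$1$2) (A$2$1) (A$2$2) z = \<phi> z}"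

definition lft_S :: "complex \<Rightarrow> (complex^2^2) set"
  where "lft_S a = lft_class (\<lambda>z. a * z)"

definition lft_S' :: "complex \<Rightarrow> (complex^2^2) set"
  where "lft_S' a = lft_class (\<lambda>z. - a / z)"

definition lft_T :: "complex \<Rightarrow> (complex^2^2) set"
  where "lft_T v = lft_class (\<lambda>z. z + v)"

lemma psl_eq: "psl A = {A, - A}"
proof -
  have "(- mat 1) ** A = - A" for A :: "complex^2^2"
    by (simp add: vec_eq_iff matrix_matrix_mult_def mat_def sum_2 forall_2)
  then show ?thesis by (auto simp: psl_def r_coset_def SL2_def)
qed

lemma lft_class_eq_psl:
  assumes "A \<in> lft_class \<phi>"
  shows "lft_class \<phi> = psl A"
proof -
  define a b c d where abcd: "a = A$1$1" "b = A$1$2" "c = A$2$1" "d = A$2$2"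
  have detA: "a * d - b * c = 1"
    using assms by (simp add: lft_class_def SL2_def det_2 abcd)
  have eqA: "(a * z + b) / (c * z + d) = \<phi> z" if "c * z + d \<noteq> 0" for z
    using assms that by (simp add: lft_class_def moebius_def abcd)
  have "B \<in> psl A" if B: "B \<in> lft_class \<phi>" for B
  proof -
    define a' b' c' d' where abcd': "a' = B$1$1" "b' = B$1$2" "c' = B$2$1" "d' = B$2$2"
    have detB: "a' * d' - b' * c' = 1"
      using B by (simp add: lft_class_def SL2_def det_2 abcd')
    have eqB: "(a' * z + b') / (c' * z + d') = \<phi> z" if "c' * z + d' \<noteq> 0" for z
      using B that by (simp add: lft_class_def moebius_def abcd')
    let ?P = "[:b, a:] * [:d', c':] - [:b', a':] * [:d, c:]"
    have "poly (?P * ([:d, c:] * [:d', c':])) z = 0" for z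
    proof (cases "c * z + d = 0 \<or> c' * z + d' = 0")
      case False
      then have "(a * z + b) / (c * z + d) = (a' * z + b') / (c' * z + d')"
        using eqA eqB by simp
      then have "(a * z + b) * (c' * z + d') = (a' * z + b') * (c * z + d)"
        using False by (simp add: frac_eq_eq)
      then have "poly ?P z = 0" by (simp add: algebra_simps)
      then show ?thesis by (simp only: poly_mult mult_zero_left)
    next
      case True
      then have "poly [:d, c:] z = 0 \<or> poly [:d', c':] z = 0" by (simp add: algebra_simps)
      then show ?thesis by (auto simp only: poly_mult mult_zero_left mult_zero_right)
    qed
    then have "?P * ([:d, c:] * [:d', c':]) = 0"
      by (intro iffD1[OF poly_all_0_iff_0] allI)
    moreover have "[:d, c:] \<noteq> 0" "[:d', c':] \<noteq> 0" using detA detB by auto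
    ultimately have "?P = 0" by (simp only: mult_eq_0_iff) blast
    then have e: "b * d' = b' * d" "a * d' + b * c' = a' * d + b' * c" "a * c' = a' * c"
      by (auto simp: algebra_simps)
    define k where "k = a' * d - b' * c"
    have k: "a' = k * a" "b' = k * b" "c' = k * c" "d' = k * d"
      using detA e unfolding k_def by algebra+
    have "k\<^sup>2 * (a * d - b * c) = 1" using detB unfolding k by algebra
    then have "k = 1 \<or> k = - 1" using detA by (simp add: power2_eq_1_iff)
    then show ?thesis
      using k by (auto simp: psl_eq vec_eq_iff forall_2 abcd abcd')
  qed
  moreover have "- A \<in> lft_class \<phi>"
  proof -
    have "(- a * z + - b) / (- c * z + - d) = \<phi> z" if "- c * z + - d \<noteq> 0" for z
    proof -
      have "c * z + d \<noteq> 0" using that by (metis add_eq_0_iff minus_mult_left add.inverse_inverse)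
      then show ?thesis using eqA[of z] minus_divide_divide[of "a * z + b" "c * z + d"] by simp
    qed
    moreover have "det (- A) = 1" using detA by (simp add: det_2 abcd)
    ultimately show ?thesis
      unfolding lft_class_def SL2_def moebius_def abcd by simp
  qed
  ultimately show ?thesis using assms by (auto simp: psl_eq)
qed

lemma lft_S_eq:
  "s \<noteq> 0 \<Longrightarrow> lft_S (s\<^sup>2) = psl (vector [vector [s, 0], vector [0, inverse s]])"
  unfolding lft_S_def
  by (rule lft_class_eq_psl)
    (simp add: lft_class_def SL2_def det_2 moebius_def field_simps power2_eq_square)

lemma lft_S'_eq:
  "s \<noteq> 0 \<Longrightarrow> lft_S' (s\<^sup>2) = psl (vector [vector [0, - s], vector [inverse s, 0]])"
  unfolding lft_S'_def
  by (rule lft_class_eq_psl)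
    (simp add: lft_class_def SL2_def det_2 moebius_def field_simps power2_eq_square)

lemma lft_T_eq: "lft_T v = psl (vector [vector [1, v], vector [0, 1]])"
  unfolding lft_T_def
  by (rule lft_class_eq_psl) (simp add: lft_class_def SL2_def det_2 moebius_def)


section \<open>The subsets $X_\tau$ and the associated quandle triplets\<close>

text \<open>The class $[t]$ in $\mathcal{T} = \mathbb{C}/(z \sim -z)$.\<close>

definition pm :: "complex \<Rightarrow> complex set"
  where "pm t = {t, - t}"

definition \<T> :: "complex set set"
  where "\<T> = range pm"

definition X_tau :: "complex set \<Rightarrow> (complex^2^2) set set"
  where "X_tau \<tau> = {psl A | A. A \<in> carrier SL2 \<and> psl A \<noteq> \<one>\<^bsub>PSL2\<^esub> \<and> trace A \<in> \<tau>}"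

definition H_tau :: "complex set \<Rightarrow> (complex^2^2) set set"
  where "H_tau \<tau> =
    (if \<tau> = pm 2 then range lft_T
     else if \<tau> = pm 0 then lft_S ` (- {0}) \<union> lft_S' ` (- {0})
     else lft_S ` (- {0}))"

text \<open>\<open>is_lambda t l\<close> says that \<open>l\<close> is a possible choice of $\lambda_t$, where
  $t \neq \pm 2$; for $t \in (-2,2)$ it still depends on the choice of $\theta$.\<close>

definition is_lambda :: "complex \<Rightarrow> complex \<Rightarrow> bool"
  where "is_lambda t l \<longleftrightarrow>
    (\<exists>\<theta>::real. t = complex_of_real (2 * cos \<theta>) \<and> 2 * cos \<theta> \<in> {-2<..<2} \<and> \<theta> \<in> {-pi<..<pi} \<and>
       l = exp (\<i> * complex_of_real \<theta>)) \<or>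
    (t \<notin> complex_of_real ` {-2..2} \<and> t = l + inverse l \<and> norm l > 1)"

text \<open>The argument \<open>l\<close> assigns to every $\tau \neq [2]$ the chosen value $\lambda_t$ for the
  chosen representative \<open>t\<close> of \<open>\<tau>\<close>.\<close>

definition f_tau :: "(complex set \<Rightarrow> complex) \<Rightarrow> complex set \<Rightarrow> (complex^2^2) set"
  where "f_tau l \<tau> = (if \<tau> = pm 2 then lft_T 1 else lft_S ((l \<tau>)\<^sup>2))"

definition sigma_tau ::
    "(complex set \<Rightarrow> complex) \<Rightarrow> complex set \<Rightarrow> (complex^2^2) set \<Rightarrow> (complex^2^2) set"
  where "sigma_tau l \<tau> g = inv\<^bsub>PSL2\<^esub> (f_tau l \<tau>) \<otimes>\<^bsub>PSL2\<^esub> g \<otimes>\<^bsub>PSL2\<^esub> f_tau l \<tau>"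

definition coset_topology :: "(complex^2^2) set set \<Rightarrow> (complex^2^2) set set topology"
  where "coset_topology K = quotient_topology PSL2_topology (\<lambda>g. K #>\<^bsub>PSL2\<^esub> g)"

end

theory Submission
  imports Defs
begin

text \<open>A non-scalar matrix \<open>M\<close> of determinant 1 and trace \<open>t\<close> is conjugate within \<open>SL2\<close> to the
  companion matrix of \<open>X\<^sup>2 - t X + 1\<close>. Hence \<open>X_tau (pm t)\<close> is one conjugacy class, the image of the
  set \<open>Y_t t\<close> of these matrices. The conjugator depends continuously on \<open>M\<close> where the upper right
  entry of \<open>M\<close> has positive real part, and conjugates of this region cover \<open>Y_t t\<close>. So the orbit
  map \<open>g \<mapsto> g\<inverse> f g\<close> has continuous local sections and is a quotient map, which identifies
  \<open>X_tau (pm t)\<close> with the cosets of the centralizer of \<open>f\<close>. On the same regions the first row is a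
  chart: it determines \<open>M\<close>, and the transition maps are, up to a sign, rational. The inner
  automorphisms act transitively on the class because it generates \<open>PSL2\<close>.\<close>

section \<open>Conjugation quandles of groups\<close>

text \<open>Comparing with a companion matrix, rather than with a diagonal or triangular form,
  treats the parabolic class \<tau> = [2] like every other one; case distinctions over \<tau> are
  confined to \<open>f_tau\<close> and its centralizer. Two obstacles shape the rest. One is the
  sign in \<open>psl\<close>: on \<open>Y_t t\<close> the map is injective except for t = 0, where
  it identifies A with -A. This is also the case in which the centralizer acquires the
  transformations S'. The other is the square root that normalizes the determinant of the
  conjugator: it has no continuous branch on all nonzero values of the upper right entry.
  Restricting that entry to a half-plane settles both, since a half-plane carries a branch of the
  root and is disjoint from its negative. Finally, being one orbit of conjugation by the whole group
  makes a class a component of \<open>Conj\<close>, but its connectedness as a quandle of its own is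
  stronger: there only products of elements of the class and their inverses may conjugate.\<close>

definition conj_class :: "('a, 'c) monoid_scheme \<Rightarrow> 'a \<Rightarrow> 'a set"
  where "conj_class G f = (\<lambda>g. inv\<^bsub>G\<^esub> g \<otimes>\<^bsub>G\<^esub> f \<otimes>\<^bsub>G\<^esub> g) ` carrier G"

definition conj_invariant :: "('a, 'c) monoid_scheme \<Rightarrow> 'a set \<Rightarrow> bool"
  where "conj_invariant G Y \<longleftrightarrow> Y \<subseteq> carrier G \<and>
    (\<forall>y\<in>Y. \<forall>g\<in>carrier G. inv\<^bsub>G\<^esub> g \<otimes>\<^bsub>G\<^esub> y \<otimes>\<^bsub>G\<^esub> g \<in> Y)"

definition conj_act :: "('a, 'c) monoid_scheme \<Rightarrow> 'a set \<Rightarrow> 'a \<Rightarrow> 'a \<Rightarrow> 'a"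
  where "conj_act G Y g = (\<lambda>x\<in>Y. inv\<^bsub>G\<^esub> g \<otimes>\<^bsub>G\<^esub> x \<otimes>\<^bsub>G\<^esub> g)"

definition centralizer :: "('a, 'c) monoid_scheme \<Rightarrow> 'a \<Rightarrow> 'a set"
  where "centralizer G f = {h \<in> carrier G. f \<otimes>\<^bsub>G\<^esub> h = h \<otimes>\<^bsub>G\<^esub> f}"

context group
begin

lemma conj_mult:
  assumes "x \<in> carrier G" "g \<in> carrier G" "h \<in> carrier G"
  shows "inv h \<otimes> (inv g \<otimes> x \<otimes> g) \<otimes> h = inv (g \<otimes> h) \<otimes> x \<otimes> (g \<otimes> h)"
  using assms by (simp add: inv_mult_group m_assoc)

lemma conj_hom:
  assumes "x \<in> carrier G" "y \<in> carrier G" "g \<in> carrier G"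
  shows "inv g \<otimes> (x \<otimes> y) \<otimes> g = (inv g \<otimes> x \<otimes> g) \<otimes> (inv g \<otimes> y \<otimes> g)"
proof -
  have "g \<otimes> (inv g \<otimes> (y \<otimes> g)) = y \<otimes> g"
    using assms by (simp flip: m_assoc)
  then show ?thesis using assms by (simp add: m_assoc)
qed

lemma conj_inv:
  assumes "x \<in> carrier G" "g \<in> carrier G"
  shows "inv g \<otimes> inv x \<otimes> g = inv (inv g \<otimes> x \<otimes> g)"
  using assms by (simp add: inv_mult_group m_assoc)

lemma conj_invariant_carrier: "conj_invariant G (carrier G)"
  by (simp add: conj_invariant_def)

lemma conj_invariant_conj_class: "f \<in> carrier G \<Longrightarrow> conj_invariant G (conj_class G f)"
  by (auto simp: conj_invariant_def conj_class_def conj_mult)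

lemma conj_act_bij:
  assumes Y: "conj_invariant G Y" and g: "g \<in> carrier G"
  shows "bij_betw (\<lambda>x. inv g \<otimes> x \<otimes> g) Y Y"
proof (rule bij_betw_byWitness[where f' = "\<lambda>x. inv (inv g) \<otimes> x \<otimes> inv g"])
  have "Y \<subseteq> carrier G" using Y by (simp add: conj_invariant_def)
  then show "\<forall>a\<in>Y. inv (inv g) \<otimes> (inv g \<otimes> a \<otimes> g) \<otimes> inv g = a"
    "\<forall>a\<in>Y. inv g \<otimes> (inv (inv g) \<otimes> a \<otimes> inv g) \<otimes> g = a"
    using g by (auto simp only: conj_mult inv_closed r_inv l_inv inv_one l_one r_one subset_iff)
qed (use Y g in \<open>auto simp only: conj_invariant_def image_subset_iff inv_closed\<close>)

lemma quandle_Conj_on: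
  assumes Y: "conj_invariant G Y" and ne: "Y \<noteq> {}"
  shows "quandle (Conj_on G Y)"
proof
  have sub: "Y \<subseteq> carrier G" using Y by (simp add: conj_invariant_def)
  show "carrier (Conj_on G Y) \<noteq> {}" using ne by (simp add: Conj_on_def)
  show "x \<triangleleft>\<^bsub>Conj_on G Y\<^esub> x = x" if "x \<in> carrier (Conj_on G Y)" for x
    using that sub by (auto simp: Conj_on_def)
  show "bij_betw (\<lambda>x. x \<triangleleft>\<^bsub>Conj_on G Y\<^esub> y) (carrier (Conj_on G Y)) (carrier (Conj_on G Y))"
    if "y \<in> carrier (Conj_on G Y)" for y
    using that sub conj_act_bij[OF Y] by (auto simp: Conj_on_def)
  show "(x \<triangleleft>\<^bsub>Conj_on G Y\<^esub> y) \<triangleleft>\<^bsub>Conj_on G Y\<^esub> z =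
      (x \<triangleleft>\<^bsub>Conj_on G Y\<^esub> z) \<triangleleft>\<^bsub>Conj_on G Y\<^esub> (y \<triangleleft>\<^bsub>Conj_on G Y\<^esub> z)"
    if "x \<in> carrier (Conj_on G Y)" "y \<in> carrier (Conj_on G Y)" "z \<in> carrier (Conj_on G Y)"
    for x y z
  proof -
    have "x \<in> carrier G" "y \<in> carrier G" "z \<in> carrier G"
      using that sub by (auto simp: Conj_on_def)
    then have "inv z \<otimes> (inv y \<otimes> x \<otimes> y) \<otimes> z =
        inv (inv z \<otimes> y \<otimes> z) \<otimes> (inv z \<otimes> x \<otimes> z) \<otimes> (inv z \<otimes> y \<otimes> z)"
      by (simp only: conj_hom[of "inv y \<otimes> x" y z] conj_hom[of "inv y" x z] conj_inv m_closed inv_closed)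
    then show ?thesis by (simp add: Conj_on_def)
  qed
qed

section \<open>Inner automorphisms of a conjugation quandle\<close>

lemma conj_act_in_BijGroup:
  "\<lbrakk>conj_invariant G Y; g \<in> carrier G\<rbrakk> \<Longrightarrow> conj_act G Y g \<in> carrier (BijGroup Y)"
  using conj_act_bij[of Y g] bij_betw_cong[of Y "conj_act G Y g" "\<lambda>x. inv g \<otimes> x \<otimes> g"]
  by (simp add: BijGroup_def Bij_def conj_act_def)

lemma conj_act_one: "conj_invariant G Y \<Longrightarrow> conj_act G Y \<one> = \<one>\<^bsub>BijGroup Y\<^esub>"
  unfolding BijGroup_def conj_act_def conj_invariant_def monoid.simps
  by (intro restrict_ext) (auto simp: subset_iff)

text \<open>Conjugation acts from the right, while \<open>BijGroup\<close> composes maps in the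
  usual order; hence the reversal of the factors.\<close>

lemma conj_act_mult:
  assumes Y: "conj_invariant G Y" and g: "g \<in> carrier G" and h: "h \<in> carrier G"
  shows "conj_act G Y g \<otimes>\<^bsub>BijGroup Y\<^esub> conj_act G Y h = conj_act G Y (h \<otimes> g)"
proof -
  have "conj_act G Y g \<in> Bij Y" "conj_act G Y h \<in> Bij Y"
    using conj_act_in_BijGroup[OF Y] g h by (auto simp: BijGroup_def)
  then have "conj_act G Y g \<otimes>\<^bsub>BijGroup Y\<^esub> conj_act G Y h =
      compose Y (conj_act G Y g) (conj_act G Y h)"
    by (simp add: BijGroup_def)
  also have "\<dots> = conj_act G Y (h \<otimes> g)"
    unfolding compose_def conj_act_def
    using Y g h by (intro restrict_ext) (auto simp: conj_invariant_def conj_mult subset_iff)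
  finally show ?thesis .
qed

lemma conj_act_inv:
  assumes Y: "conj_invariant G Y" and g: "g \<in> carrier G"
  shows "inv\<^bsub>BijGroup Y\<^esub> (conj_act G Y g) = conj_act G Y (inv g)"
proof -
  interpret B: group "BijGroup Y" by (rule group_BijGroup)
  show ?thesis
    using assms by (intro B.inv_equality)
      (simp_all add: conj_act_mult conj_act_in_BijGroup flip: conj_act_one)
qed

text \<open>An antihomomorphism maps the subgroup generated by \<open>Y\<close> onto the subgroup
  generated by the image of \<open>Y\<close>; both inclusions are inductions over
  \<open>generate\<close>.\<close>

lemma carrier_Inn_Conj_on:
  assumes Y: "conj_invariant G Y"
  shows "carrier (Inn (Conj_on G Y)) = conj_act G Y ` generate G Y"
proof -
  interpret B: group "BijGroup Y" by (rule group_BijGroup)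
  have sub: "Y \<subseteq> carrier G" using Y by (simp add: conj_invariant_def)
  note gc = generate_in_carrier[OF sub]
  have "carrier (Inn (Conj_on G Y)) =
      generate (BijGroup Y) (carrier (BijGroup Y) \<inter> conj_act G Y ` Y)"
    by (simp add: Inn_def carrier_subgroup_generated Conj_on_def conj_act_def)
  \<comment> \<open>\<open>subgroup_generated\<close> intersects the generators with the carrier;
    nothing is lost, since conjugations permute \<open>Y\<close>.\<close>
  also have "carrier (BijGroup Y) \<inter> conj_act G Y ` Y = conj_act G Y ` Y"
    using conj_act_in_BijGroup[OF Y] sub by auto
  also have "generate (BijGroup Y) (conj_act G Y ` Y) = conj_act G Y ` generate G Y"
  proof
    show "generate (BijGroup Y) (conj_act G Y ` Y) \<subseteq> conj_act G Y ` generate G Y"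
    proof
      fix f assume "f \<in> generate (BijGroup Y) (conj_act G Y ` Y)"
      then show "f \<in> conj_act G Y ` generate G Y"
      proof induction
        case one
        show ?case by (metis Y conj_act_one generate.one image_eqI)
      next
        case (incl h)
        then show ?case by (blast intro: generate.incl)
      next
        case (inv h)
        then obtain y where y: "y \<in> Y" "h = conj_act G Y y" by blast
        then have "inv\<^bsub>BijGroup Y\<^esub> h = conj_act G Y (inv y)"
          using conj_act_inv[OF Y, of y] sub by auto
        then show ?case using y by (blast intro: generate.inv)
      next
        case (eng h1 h2)
        then obtain g1 g2 where g: "g1 \<in> generate G Y" "h1 = conj_act G Y g1"
          "g2 \<in> generate G Y" "h2 = conj_act G Y g2" by blast
        then have "h1 \<otimes>\<^bsub>BijGroup Y\<^esub> h2 = conj_act G Y (g2 \<otimes> g1)"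
          using conj_act_mult[OF Y] gc by auto
        then show ?case using g by (blast intro: generate.eng)
      qed
    qed
    show "conj_act G Y ` generate G Y \<subseteq> generate (BijGroup Y) (conj_act G Y ` Y)"
    proof (rule image_subsetI)
      fix g assume "g \<in> generate G Y"
      then show "conj_act G Y g \<in> generate (BijGroup Y) (conj_act G Y ` Y)"
      proof induction
        case one
        show ?case by (metis Y conj_act_one generate.one)
      next
        case (incl h)
        then show ?case by (blast intro: generate.incl)
      next
        case (inv h)
        then show ?case
          using conj_act_inv[OF Y, of h] sub generate.inv[of "conj_act G Y h" "conj_act G Y ` Y" "BijGroup Y"]
          by (metis imageI subsetD)
      next
        case (eng h1 h2)
        have "conj_act G Y (h1 \<otimes> h2) = conj_act G Y h2 \<otimes>\<^bsub>BijGroup Y\<^esub> conj_act G Y h1"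
          using conj_act_mult[OF Y] gc eng by auto
        then show ?case using eng.IH by (simp add: generate.eng)
      qed
    qed
  qed
  finally show ?thesis .
qed

lemma quandle_components_Conj: "quandle_components (Conj G) = conj_class G ` carrier G"
proof -
  have "generate G (carrier G) = carrier G"
    using generate_in_carrier[of "carrier G"] by (auto intro: generate.incl)
  then have inn: "carrier (Inn (Conj G)) = conj_act G (carrier G) ` carrier G"
    using carrier_Inn_Conj_on[OF conj_invariant_carrier] by simp
  have "orbit (Inn (Conj G)) (\<lambda>f. f) x = conj_class G x" if "x \<in> carrier G" for x
  proof -
    have "orbit (Inn (Conj G)) (\<lambda>f. f) x = (\<lambda>k. k x) ` carrier (Inn (Conj G))"
      unfolding orbit_def by (rule Setcompr_eq_image)
    then show ?thesis using that by (simp add: inn image_image conj_class_def conj_act_def)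
  qed
  then show ?thesis by (auto simp: quandle_components_def orbits_def Conj_on_def)
qed

lemma conj_class_self: "f \<in> carrier G \<Longrightarrow> f \<in> conj_class G f"
  unfolding conj_class_def by (rule image_eqI[of _ _ \<one>]) simp_all

text \<open>The inner automorphisms of the class are conjugations by the subgroup that it generates.
  By \<open>gen\<close> this includes all of G, which is transitive on the class.\<close>

lemma connected_quandle_conj_class:
  assumes f: "f \<in> carrier G" and gen: "generate G (conj_class G f) = carrier G"
  shows "connected_quandle (Conj_on G (conj_class G f))"
proof -
  let ?Y = "conj_class G f"
  note Y = conj_invariant_conj_class[OF f]
  have "\<exists>k\<in>carrier (Inn (Conj_on G ?Y)). k x = y" if x: "x \<in> ?Y" and y: "y \<in> ?Y" for x y
  proof -
    obtain g where g: "g \<in> carrier G" "x = inv g \<otimes> f \<otimes> g"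
      using x by (auto simp: conj_class_def)
    obtain h where h: "h \<in> carrier G" "y = inv h \<otimes> f \<otimes> h"
      using y by (auto simp: conj_class_def)
    have gh: "g \<otimes> (inv g \<otimes> h) = h" using g(1) h(1) by (simp flip: m_assoc)
    \<comment> \<open>The conjugator from x to y passes through the base point f.\<close>
    have "inv (inv g \<otimes> h) \<otimes> x \<otimes> (inv g \<otimes> h) = y"
      unfolding g(2) h(2) using f g(1) h(1) gh by (simp only: conj_mult m_closed inv_closed)
    then have "conj_act G ?Y (inv g \<otimes> h) x = y"
      using x by (simp add: conj_act_def)
    then show ?thesis
      using g h by (auto simp: carrier_Inn_Conj_on[OF Y] gen)
  qed
  moreover have "?Y \<noteq> {}" using conj_class_self[OF f] by blast
  ultimately show ?thesis
    using quandle_Conj_on[OF Y] by (simp add: connected_quandle_def) (simp add: Conj_on_def)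
qed

section \<open>Centralizers, cosets and the triplet quandle\<close>

lemma subgroup_centralizer:
  assumes f: "f \<in> carrier G"
  shows "subgroup (centralizer G f) G"
proof
  fix x y assume x: "x \<in> centralizer G f" and y: "y \<in> centralizer G f"
  have c: "x \<in> carrier G" "y \<in> carrier G" "f \<otimes> x = x \<otimes> f" "f \<otimes> y = y \<otimes> f"
    using x y by (simp_all add: centralizer_def)
  have "f \<otimes> (x \<otimes> y) = (f \<otimes> x) \<otimes> y" using c(1,2) f by (simp only: m_assoc)
  also have "\<dots> = x \<otimes> (f \<otimes> y)" unfolding c(3) using c(1,2) f by (simp only: m_assoc)
  also have "\<dots> = (x \<otimes> y) \<otimes> f" unfolding c(4) using c(1,2) f by (simp only: m_assoc)
  finally show "x \<otimes> y \<in> centralizer G f" using c by (simp add: centralizer_def)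
next
  fix x assume x: "x \<in> centralizer G f"
  have c: "x \<in> carrier G" "f \<otimes> x = x \<otimes> f" using x by (simp_all add: centralizer_def)
  have "inv x \<otimes> f = inv x \<otimes> (f \<otimes> x) \<otimes> inv x" using c(1) f by (simp add: m_assoc)
  also have "\<dots> = f \<otimes> inv x" unfolding c(2) using c(1) f by (simp flip: m_assoc)
  finally show "inv x \<in> centralizer G f" using c by (simp add: centralizer_def)
qed (use f in \<open>auto simp: centralizer_def\<close>)

text \<open>Orbit-stabilizer for conjugation: the fibres of the orbit map of f are the right cosets
  of its stabilizer. Both the quandle isomorphism and the homeomorphism with the coset space rest on
  this.\<close>

lemma conj_eq_iff_centralizer:
  assumes f: "f \<in> carrier G" and x: "x \<in> carrier G" and y: "y \<in> carrier G"
  shows "inv x \<otimes> f \<otimes> x = inv y \<otimes> f \<otimes> y \<longleftrightarrow> centralizer G f #> x = centralizer G f #> y"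
proof -
  note H = subgroup_centralizer[OF f]
  note sub = subgroup.subset[OF H]
  have xy: "x \<otimes> inv y \<in> carrier G" using x y by simp
  have "inv x \<otimes> f \<otimes> x = inv y \<otimes> f \<otimes> y \<longleftrightarrow>
      inv (inv y) \<otimes> (inv x \<otimes> f \<otimes> x) \<otimes> inv y = inv (inv y) \<otimes> (inv y \<otimes> f \<otimes> y) \<otimes> inv y"
    using assms by (metis inv_closed m_closed Units_eq Units_l_cancel right_cancel)
  also have "\<dots> \<longleftrightarrow> inv (x \<otimes> inv y) \<otimes> f \<otimes> (x \<otimes> inv y) = f"
    using assms by (simp only: conj_mult inv_closed r_inv inv_one l_one r_one)
  also have "\<dots> \<longleftrightarrow> f \<otimes> (x \<otimes> inv y) = (x \<otimes> inv y) \<otimes> f"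
    using f x y inv_solve_left'[of f "x \<otimes> inv y" "f \<otimes> (x \<otimes> inv y)"]
    by (simp only: m_assoc[of "inv _"] m_closed inv_closed)
  also have "\<dots> \<longleftrightarrow> x \<otimes> inv y \<in> centralizer G f"
    using assms by (simp add: centralizer_def)
  also have "\<dots> \<longleftrightarrow> centralizer G f #> (x \<otimes> inv y) = centralizer G f"
    using coset_join1[OF _ xy H] coset_join2[OF xy H] by (rule iffI[rotated])
  also have "\<dots> \<longleftrightarrow> centralizer G f #> x = centralizer G f #> y"
    using coset_mult_inv1[OF _ x y sub] coset_mult_inv2[OF _ x y sub] by (rule iffI)
  finally show ?thesis .
qed

lemma conj_iso:
  assumes f: "f \<in> carrier G"
  shows "(\<lambda>g. inv f \<otimes> g \<otimes> f) \<in> iso G G"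
proof -
  have "(\<lambda>g. inv f \<otimes> g \<otimes> f) \<in> hom G G"
    using f by (intro homI) (simp_all only: conj_hom m_closed inv_closed)
  then show ?thesis using conj_act_bij[OF conj_invariant_carrier f] by (simp add: iso_def)
qed

lemma quandle_triplet_centralizer:
  assumes f: "f \<in> carrier G"
  shows "quandle_triplet G (centralizer G f) (\<lambda>g. inv f \<otimes> g \<otimes> f)"
proof -
  have "inv f \<otimes> h \<otimes> f = h" if "h \<in> centralizer G f" for h
    using that f unfolding centralizer_def by (simp add: m_assoc) (metis inv_solve_left' m_closed)
  then show ?thesis
    using subgroup_centralizer[OF f] conj_iso[OF f] is_group
    by (auto simp: quandle_triplet_def centralizer_def)
qed

text \<open>The inverse of the orbit map on cosets preserves the operation because left
  multiplication by the inverse of f, an element of the centralizer, does not change the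
  coset.\<close>

lemma conj_class_isomorphic_triplet_quandle:
  assumes f: "f \<in> carrier G"
  shows "quandle_isomorphic (Conj_on G (conj_class G f))
    (triplet_quandle G (centralizer G f) (\<lambda>g. inv f \<otimes> g \<otimes> f))"
proof -
  let ?H = "centralizer G f" and ?s = "\<lambda>g. inv f \<otimes> g \<otimes> f" and ?c = "\<lambda>x. inv x \<otimes> f \<otimes> x"
  let ?T = "triplet_quandle G ?H ?s"
  \<comment> \<open>An arbitrary conjugator from f to X; its coset does not depend on the
    choice.\<close>
  define r where "r X = (SOME x. x \<in> carrier G \<and> ?c x = X)" for X
  define \<phi> where "\<phi> X = ?H #> r X" for X
  have \<phi>: "\<phi> (?c x) = ?H #> x" if "x \<in> carrier G" for x
  proof -
    have "r (?c x) \<in> carrier G \<and> ?c (r (?c x)) = ?c x"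
      unfolding r_def by (rule someI[where x = x]) (use that in simp)
    then show ?thesis unfolding \<phi>_def using conj_eq_iff_centralizer[OF f, of "r (?c x)" x] that by simp
  qed
  have "bij_betw \<phi> (conj_class G f) (rcosets ?H)"
  proof (rule bij_betw_imageI)
    show "inj_on \<phi> (conj_class G f)"
      using \<phi> conj_eq_iff_centralizer[OF f] by (auto simp: inj_on_def conj_class_def)
    show "\<phi> ` conj_class G f = rcosets ?H"
      using \<phi> by (force simp: conj_class_def RCOSETS_def)
  qed
  moreover have "\<phi> (X \<triangleleft>\<^bsub>Conj_on G (conj_class G f)\<^esub> Y) = \<phi> X \<triangleleft>\<^bsub>?T\<^esub> \<phi> Y"
    if X: "X \<in> conj_class G f" and Y: "Y \<in> conj_class G f" for X Y
  proof -
    obtain x y where x: "x \<in> carrier G" "X = ?c x" and y: "y \<in> carrier G" "Y = ?c y"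
      using X Y by (auto simp: conj_class_def)
    have fx: "inv f \<otimes> f \<otimes> f = f" using f by simp
    define u where "u = x \<otimes> inv y \<otimes> f \<otimes> y"
    have u: "u \<in> carrier G" using x y f by (simp add: u_def)
    have "X \<triangleleft>\<^bsub>Conj_on G (conj_class G f)\<^esub> Y = inv Y \<otimes> (inv x \<otimes> f \<otimes> x) \<otimes> Y"
      by (simp add: Conj_on_def x)
    also have "\<dots> = inv (x \<otimes> Y) \<otimes> f \<otimes> (x \<otimes> Y)"
      using x y f by (simp add: conj_mult)
    also have "x \<otimes> Y = u" using x y f by (simp add: u_def m_assoc)
    \<comment> \<open>The factor \<open>inv f\<close> turns x y^-1 f y into the representative
      \<sigma>(x y^-1) y that occurs in the triplet operation.\<close>
    also have "inv u \<otimes> f \<otimes> u = ?c (inv f \<otimes> u)"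
      using conj_mult[of f "inv f" u] f u by (simp add: m_assoc)
    also have "inv f \<otimes> u = ?s (x \<otimes> inv y) \<otimes> y" using x y f by (simp add: u_def m_assoc)
    finally have "\<phi> (X \<triangleleft>\<^bsub>Conj_on G (conj_class G f)\<^esub> Y) = ?H #> (?s (x \<otimes> inv y) \<otimes> y)"
      using x y f by (simp add: \<phi>)
    also have "\<dots> = (?H #> x) \<triangleleft>\<^bsub>?T\<^esub> (?H #> y)"
      using triplet_quandle_op[OF quandle_triplet_centralizer[OF f] x(1) y(1)] by simp
    finally show ?thesis using x y by (simp add: \<phi>)
  qed
  ultimately show ?thesis
    unfolding quandle_isomorphic_def by (intro exI[of _ \<phi>]) (simp add: Conj_on_def triplet_quandle_def)
qed

end

section \<open>Matrices of size two\<close>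

definition mat2 :: "'a \<Rightarrow> 'a \<Rightarrow> 'a \<Rightarrow> 'a \<Rightarrow> 'a::zero^2^2"
  where "mat2 a b c d = vector [vector [a, b], vector [c, d]]"

lemma mat2_nth [simp]:
  "mat2 a b c d $ 1 $ 1 = a" "mat2 a b c d $ 1 $ 2 = b"
  "mat2 a b c d $ 2 $ 1 = c" "mat2 a b c d $ 2 $ 2 = d"
  by (simp_all add: mat2_def)

lemma mat2_eq_iff:
  "A = B \<longleftrightarrow> A$1$1 = B$1$1 \<and> A$1$2 = B$1$2 \<and> A$2$1 = B$2$1 \<and> A$2$2 = B$2$2"
  for A B :: "'a^2^2"
  by (auto simp: vec_eq_iff forall_2)

lemma mat2_cases:
  obtains a b c d where "A = mat2 a b c d"
  using mat2_eq_iff[of A "mat2 (A$1$1) (A$1$2) (A$2$1) (A$2$2)"] by simp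

lemma mat2_inject [simp]: "mat2 a b c d = mat2 a' b' c' d' \<longleftrightarrow> a = a' \<and> b = b' \<and> c = c' \<and> d = d'"
  by (simp add: mat2_eq_iff)

lemma mat2_mult [simp]:
  "mat2 a b c d ** mat2 a' b' c' d' =
    mat2 (a * a' + b * c') (a * b' + b * d') (c * a' + d * c') (c * b' + d * d')"
  by (simp add: mat2_eq_iff matrix_matrix_mult_def sum_2)

lemma mat2_one: "mat 1 = mat2 1 0 0 1"
  by (simp add: mat2_eq_iff mat_def)

lemma mat2_uminus [simp]: "- mat2 a b c d = mat2 (- a) (- b) (- c) (- d :: 'a::group_add)"
  by (simp add: mat2_eq_iff)

lemma det_mat2 [simp]: "det (mat2 a b c d) = a * d - b * c"
  by (simp add: det_2)

lemma trace_2: "trace A = A$1$1 + A$2$2" for A :: "'a::comm_ring_1^2^2"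
  by (simp add: trace_def sum_2)

lemma trace_mat2 [simp]: "trace (mat2 a b c d) = a + d" for a :: "'a::comm_ring_1"
  by (simp add: trace_2)

text \<open>The adjugate: it inverts matrices of determinant 1 and has entries linear in those of A,
  so continuity and complex differentiability need no side condition.\<close>

definition adj2 :: "'a::comm_ring_1^2^2 \<Rightarrow> 'a^2^2"
  where "adj2 A = mat2 (A$2$2) (- A$1$2) (- A$2$1) (A$1$1)"

lemma adj2_mat2 [simp]: "adj2 (mat2 a b c d) = mat2 d (- b) (- c) a"
  by (simp add: adj2_def)

lemma uminus_matrix_mult:
  "(- A) ** B = - (A ** B)" "A ** (- B) = - (A ** B)" for A B :: "'a::comm_ring_1^2^2"
  by (simp_all add: mat2_eq_iff matrix_matrix_mult_def sum_2)

lemma trace_uminus: "trace (- A) = - trace A" for A :: "'a::comm_ring_1^2^2"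
  by (simp add: trace_2)

lemma det_uminus2: "det (- A) = det A" for A :: "'a::comm_ring_1^2^2"
  by (simp add: det_2)


section \<open>The groups \<open>SL2\<close> and \<open>PSL2\<close>\<close>

lemma carrier_SL2 [simp]: "A \<in> carrier SL2 \<longleftrightarrow> det A = 1"
  and mult_SL2 [simp]: "A \<otimes>\<^bsub>SL2\<^esub> B = A ** B"
  and one_SL2 [simp]: "\<one>\<^bsub>SL2\<^esub> = mat 1"
  by (simp_all add: SL2_def)

lemma det_adj2 [simp]: "det (adj2 A) = det A"
  by (cases A rule: mat2_cases) (simp add: mult.commute)

lemma adj2_inverse:
  assumes "det A = 1"
  shows "adj2 A ** A = mat 1" "A ** adj2 A = mat 1"
  using assms by (cases A rule: mat2_cases; simp add: mat2_one algebra_simps)+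

lemma det_conj: "det A = 1 \<Longrightarrow> det (adj2 A ** B ** A) = det B"
  by (simp add: det_mul)

lemma trace_conj: "det A = 1 \<Longrightarrow> trace (adj2 A ** B ** A) = trace B"
  by (metis adj2_inverse(2) matrix_mul_assoc matrix_mul_lid trace_mul_sym)

lemma group_SL2: "group SL2"
  by (rule groupI) (auto simp: det_mul matrix_mul_assoc intro: exI[of _ "adj2 _"] adj2_inverse)

lemma inv_SL2: "det A = 1 \<Longrightarrow> inv\<^bsub>SL2\<^esub> A = adj2 A"
  by (rule group.inv_equality[OF group_SL2]) (auto simp: adj2_inverse)

lemma normal_center_SL2: "{mat 1, - mat 1} \<lhd> SL2"
proof -
  interpret group SL2 by (rule group_SL2)
  have "subgroup {mat 1, - mat 1} SL2"
    by (rule subgroupI) (auto simp: uminus_matrix_mult inv_SL2 det_uminus2 mat2_one)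
  moreover have "x ** h ** adj2 x \<in> {mat 1, - mat 1}"
    if "det x = 1" "h \<in> {mat 1, - mat 1}" for x h :: "complex^2^2"
    using that by (auto simp: uminus_matrix_mult adj2_inverse)
  ultimately show ?thesis
    by (simp add: normal_inv_iff inv_SL2)
qed

lemma group_PSL2: "group PSL2"
  unfolding PSL2_def by (rule normal.factorgroup_is_group[OF normal_center_SL2])

interpretation PSL2: group PSL2 by (rule group_PSL2)

lemma carrier_PSL2: "carrier PSL2 = psl ` carrier SL2"
  by (simp add: PSL2_def carrier_FactGroup psl_def[abs_def])

lemma psl_carrier [simp]: "det A = 1 \<Longrightarrow> psl A \<in> carrier PSL2"
  by (auto simp: carrier_PSL2)

lemma psl_cases:
  assumes "x \<in> carrier PSL2"
  obtains A where "det A = 1" "x = psl A"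
  using assms by (auto simp: carrier_PSL2)

lemma psl_mult [simp]: "\<lbrakk>det A = 1; det B = 1\<rbrakk> \<Longrightarrow> psl A \<otimes>\<^bsub>PSL2\<^esub> psl B = psl (A ** B)"
  using normal.rcos_sum[OF normal_center_SL2, of A B] by (simp add: PSL2_def psl_def)

lemma psl_eq_iff: "psl A = psl B \<longleftrightarrow> A = B \<or> A = - B"
  by (auto simp: psl_eq doubleton_eq_iff)

lemma one_PSL2: "\<one>\<^bsub>PSL2\<^esub> = psl (mat 1)"
  by (simp add: PSL2_def psl_eq)

lemma psl_uminus: "psl (- A) = psl A"
  by (auto simp: psl_eq)

lemma inv_psl: "det A = 1 \<Longrightarrow> inv\<^bsub>PSL2\<^esub> (psl A) = psl (adj2 A)"
  by (rule PSL2.inv_equality) (simp_all add: adj2_inverse one_PSL2)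

lemma conj_psl:
  "\<lbrakk>det A = 1; det B = 1\<rbrakk> \<Longrightarrow>
    inv\<^bsub>PSL2\<^esub> (psl A) \<otimes>\<^bsub>PSL2\<^esub> psl B \<otimes>\<^bsub>PSL2\<^esub> psl A = psl (adj2 A ** B ** A)"
  by (simp add: inv_psl det_mul)

section \<open>Conjugacy classes in \<open>SL2\<close>\<close>

text \<open>Fixing the trace t, and not only its class up to sign, gives a single conjugacy class of
  \<open>SL2\<close>. For t = 0 it is closed under negation, otherwise it contains at most one of A
  and -A.\<close>

definition Y_t :: "complex \<Rightarrow> (complex^2^2) set"
  where "Y_t t = {A. det A = 1 \<and> trace A = t \<and> A \<noteq> mat 1 \<and> A \<noteq> - mat 1}"

text \<open>On row vectors it sends e1 to e2 and e2 to t e2 - e1. By Cayley-Hamilton, M acts in the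
  same way on the pair e1, e1 M.\<close>

definition companion :: "complex \<Rightarrow> complex^2^2"
  where "companion t = mat2 0 1 (- 1) t"

lemma X_tau_eq: "X_tau (pm t) = psl ` Y_t t"
proof
  show "psl ` Y_t t \<subseteq> X_tau (pm t)"
    by (auto simp: Y_t_def X_tau_def pm_def one_PSL2 psl_eq_iff)
  show "X_tau (pm t) \<subseteq> psl ` Y_t t"
  proof
    fix x assume "x \<in> X_tau (pm t)"
    then obtain A where A: "x = psl A" "det A = 1" "A \<noteq> mat 1" "A \<noteq> - mat 1"
      "trace A = t \<or> trace A = - t"
      by (auto simp: X_tau_def pm_def one_PSL2 psl_eq_iff)
    then have "A \<in> Y_t t \<or> - A \<in> Y_t t"
      by (auto simp: Y_t_def trace_uminus det_uminus2 minus_equation_iff[of A])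
    then show "x \<in> psl ` Y_t t" using A(1) psl_uminus by (metis imageI)
  qed
qed

text \<open>If \<open>M\<close> has upper right entry \<open>b \<noteq> 0\<close>, its conjugation into companion form is
  the change to the basis of row vectors \<open>k e\<^sub>1, k e\<^sub>1 M\<close>, where \<open>k\<^sup>2 b = 1\<close> normalizes the
  determinant.\<close>

definition to_companion :: "complex^2^2 \<Rightarrow> complex^2^2"
  where "to_companion M = (let k = inverse (csqrt (M$1$2)) in mat2 k 0 (k * M$1$1) (k * M$1$2))"

lemma to_companion:
  assumes "det M = 1" "M$1$2 \<noteq> 0"
  shows "det (to_companion M) = 1"
    "adj2 (to_companion M) ** companion (trace M) ** to_companion M = M"
proof -
  obtain a b c d where M: "M = mat2 a b c d" by (rule mat2_cases)
  define s where "s = csqrt b"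
  have s: "s\<^sup>2 = b" "s \<noteq> 0" "b \<noteq> 0" using assms M by (simp_all add: s_def)
  have det: "a * d - s\<^sup>2 * c = 1" using assms M s by simp
  show "det (to_companion M) = 1"
    using s by (simp add: M to_companion_def Let_def s_def[symmetric] field_simps power2_eq_square)
  show "adj2 (to_companion M) ** companion (trace M) ** to_companion M = M"
    using s det
    by (simp add: M to_companion_def Let_def s_def[symmetric] companion_def field_simps power2_eq_square)
qed

text \<open>For g with first row r, the entry in question is the determinant of the rows r and r M,
  a quadratic form in r. It vanishes exactly when r is zero or an eigenvector, and not every row is
  an eigenvector of a non-scalar matrix.\<close>

lemma nonscalar_conj_upper_entry:
  assumes M: "det M = 1" "M \<noteq> mat 1" "M \<noteq> - mat 1"
  obtains g where "det g = 1" "Re ((g ** M ** adj2 g)$1$2) > 0"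
proof -
  obtain a b c d where abcd: "M = mat2 a b c d" by (rule mat2_cases)
  have "\<exists>x y. b * x\<^sup>2 + (d - a) * x * y - c * y\<^sup>2 \<noteq> 0"
  proof (rule ccontr)
    assume "\<not> ?thesis"
    then have *: "b * x\<^sup>2 + (d - a) * x * y - c * y\<^sup>2 = 0" for x y by blast
    have "b = 0" "c = 0" "a = d" using *[of 1 0] *[of 0 1] *[of 1 1] by auto
    then show False using M by (simp add: abcd mat2_one) (metis power2_eq_1_iff power2_eq_square)
  qed
  then obtain x y where xy: "b * x\<^sup>2 + (d - a) * x * y - c * y\<^sup>2 \<noteq> 0" by blast
  define q where "q = b * x\<^sup>2 + (d - a) * x * y - c * y\<^sup>2"
  \<comment> \<open>Scaling the row by s multiplies the form by s^2, which makes the entry equal to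
    1. The row is then completed to determinant 1 by u and v.\<close>
  define s where "s = inverse (csqrt q)"
  have s: "s\<^sup>2 * q = 1" using xy by (simp add: s_def q_def power_inverse)
  have "s * x \<noteq> 0 \<or> s * y \<noteq> 0" using s xy by (auto simp: q_def)
  then obtain u v where uv: "s * x * v - s * y * u = 1"
  proof
    assume "s * x \<noteq> 0" then show thesis by (intro that[of "inverse (s * x)" 0]) (simp add: field_simps)
  next
    assume "s * y \<noteq> 0" then show thesis by (intro that[of 0 "- inverse (s * y)"]) (simp add: field_simps)
  qed
  let ?g = "mat2 (s * x) (s * y) u v"
  have "(?g ** M ** adj2 ?g)$1$2 = s\<^sup>2 * q"
    by (simp add: abcd q_def power2_eq_square algebra_simps)
  then show thesis using that[of ?g] s uv by simp
qed

lemma Y_t_conj_companion: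
  assumes "M \<in> Y_t t"
  obtains R where "det R = 1" "adj2 R ** companion t ** R = M"
proof -
  obtain g where g: "det g = 1" "Re ((g ** M ** adj2 g)$1$2) > 0"
    using assms nonscalar_conj_upper_entry unfolding Y_t_def by auto
  let ?N = "g ** M ** adj2 g" and ?Q = "to_companion (g ** M ** adj2 g)"
  have N: "det ?N = 1" "trace ?N = t" "?N$1$2 \<noteq> 0"
    using assms g trace_mul_sym[of g "M ** adj2 g"]
    by (auto simp: det_mul Y_t_def adj2_inverse matrix_mul_assoc[symmetric])
  note Q = to_companion[OF N(1,3), unfolded N(2)]
  have adj: "adj2 (?Q ** g) = adj2 g ** adj2 ?Q"
    by (simp add: mat2_eq_iff adj2_def matrix_matrix_mult_def sum_2 algebra_simps)
  have "adj2 (?Q ** g) ** companion t ** (?Q ** g) = adj2 g ** (adj2 ?Q ** companion t ** ?Q) ** g"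
    by (simp add: adj matrix_mul_assoc)
  also have "\<dots> = (adj2 g ** g) ** M ** (adj2 g ** g)"
    unfolding Q(2) by (simp add: matrix_mul_assoc)
  also have "\<dots> = M" using g by (simp add: adj2_inverse)
  finally show thesis using that[of "?Q ** g"] Q(1) g(1) by (simp add: det_mul)
qed



lemma Y_t_conj:
  assumes "B \<in> Y_t t" "det A = 1"
  shows "adj2 A ** B ** A \<in> Y_t t"
proof -
  have B: "B = A ** (adj2 A ** B ** A) ** adj2 A"
    using assms by (metis adj2_inverse(2) matrix_mul_assoc matrix_mul_lid matrix_mul_rid)
  have "adj2 A ** B ** A \<noteq> C" if "C = mat 1 \<or> C = - mat 1" for C
  proof
    assume "adj2 A ** B ** A = C"
    then have "B = C" using B that assms by (auto simp: uminus_matrix_mult adj2_inverse)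
    then show False using assms that by (auto simp: Y_t_def)
  qed
  then show ?thesis using assms by (auto simp: Y_t_def det_conj trace_conj)
qed

lemma companion_in_Y_t: "companion t \<in> Y_t t"
  by (simp add: Y_t_def companion_def mat2_one)

lemma Y_t_transitive:
  assumes "F \<in> Y_t t" "M \<in> Y_t t"
  obtains S where "det S = 1" "adj2 S ** F ** S = M"
proof -
  obtain R where R: "det R = 1" "adj2 R ** companion t ** R = F"
    using assms(1) by (rule Y_t_conj_companion)
  obtain Q where Q: "det Q = 1" "adj2 Q ** companion t ** Q = M"
    using assms(2) by (rule Y_t_conj_companion)
  have adj: "adj2 (adj2 R ** Q) = adj2 Q ** R"
    by (simp add: mat2_eq_iff adj2_def matrix_matrix_mult_def sum_2 algebra_simps)
  have "adj2 (adj2 R ** Q) ** F ** (adj2 R ** Q) =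
      adj2 Q ** (R ** adj2 R) ** companion t ** (R ** adj2 R) ** Q"
    unfolding adj R(2)[symmetric] by (simp add: matrix_mul_assoc)
  then have "adj2 (adj2 R ** Q) ** F ** (adj2 R ** Q) = M"
    using R Q by (simp add: adj2_inverse)
  then show thesis using that[of "adj2 R ** Q"] R Q by (simp add: det_mul)
qed

section \<open>Conjugacy classes of \<open>PSL2\<close> and the group they generate\<close>

lemma X_tau_subset: "X_tau (pm t) \<subseteq> carrier PSL2"
  by (auto simp: X_tau_eq Y_t_def)

lemma X_tau_conj_class:
  assumes "f \<in> X_tau (pm t)"
  shows "X_tau (pm t) = conj_class PSL2 f"
proof -
  obtain F where F: "F \<in> Y_t t" "f = psl F" using assms by (auto simp: X_tau_eq)
  have dF: "det F = 1" using F by (simp add: Y_t_def)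
  show ?thesis
  proof
    show "conj_class PSL2 f \<subseteq> X_tau (pm t)"
      using F dF Y_t_conj[OF F(1)]
      by (auto simp: conj_class_def X_tau_eq carrier_PSL2 conj_psl)
    show "X_tau (pm t) \<subseteq> conj_class PSL2 f"
    proof
      fix x assume "x \<in> X_tau (pm t)"
      then obtain M where M: "M \<in> Y_t t" "x = psl M" by (auto simp: X_tau_eq)
      obtain S where S: "det S = 1" "adj2 S ** F ** S = M" using F(1) M(1) by (rule Y_t_transitive)
      then have "x = inv\<^bsub>PSL2\<^esub> (psl S) \<otimes>\<^bsub>PSL2\<^esub> f \<otimes>\<^bsub>PSL2\<^esub> psl S"
        using F dF M by (simp add: conj_psl)
      then show "x \<in> conj_class PSL2 f"
        unfolding conj_class_def using S(1) by (intro image_eqI[of _ _ "psl S"]) simp_all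
    qed
  qed
qed

text \<open>Over a field, elementary matrices generate the special linear group: a nonzero lower
  left entry gives a product upper, lower, upper.\<close>

lemma SL2_elementary_induct:
  fixes A :: "'a::field^2^2"
  assumes mult: "\<And>A B. \<lbrakk>P A; P B\<rbrakk> \<Longrightarrow> P (A ** B)"
    and up: "\<And>v. P (mat2 1 v 0 1)" and low: "\<And>v. P (mat2 1 0 v 1)"
    and A: "det A = 1"
  shows "P A"
proof -
  have *: "P (mat2 a b c d)" if "c \<noteq> 0" "a * d - b * c = 1" for a b c d
  proof -
    have "mat2 a b c d = mat2 1 ((a - 1) / c) 0 1 ** mat2 1 0 c 1 ** mat2 1 ((d - 1) / c) 0 1"
      using that by (simp add: field_simps)
    then show ?thesis using mult up low by metis
  qed
  obtain a b c d where abcd: "A = mat2 a b c d" by (rule mat2_cases)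
  show ?thesis
  proof (cases "c = 0")
    case False
    then show ?thesis using * A by (simp add: abcd)
  next
    case True
    \<comment> \<open>Adding the first row to the second makes the lower left entry a, which is
      nonzero because a d = 1.\<close>
    then have "P (mat2 a b a (b + d))" using A abcd by (intro *) (auto simp: algebra_simps)
    moreover have "mat2 a b c d = mat2 1 0 (- 1) 1 ** mat2 a b a (b + d)" using True by simp
    ultimately show ?thesis unfolding abcd using mult low by metis
  qed
qed

text \<open>Quotients of two triangular elements of the conjugacy class with the same diagonal are
  arbitrary unipotent matrices.\<close>

lemma generate_X_tau: "generate PSL2 (X_tau (pm t)) = carrier PSL2"
proof
  show "generate PSL2 (X_tau (pm t)) \<subseteq> carrier PSL2"
    using PSL2.generate_in_carrier[OF X_tau_subset] by blast
  define P where "P A \<longleftrightarrow> det A = 1 \<and> psl A \<in> generate PSL2 (X_tau (pm t))" for A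
  have mult: "P (A ** B)" if "P A" "P B" for A B
    using that generate.eng[of "psl A" PSL2 _ "psl B"] by (simp add: P_def det_mul)
  have quot: "P (adj2 A ** B)" if "A \<in> Y_t t" "B \<in> Y_t t" for A B
  proof -
    have AB: "det A = 1" "det B = 1" "psl A \<in> X_tau (pm t)" "psl B \<in> X_tau (pm t)"
      using that by (auto simp: Y_t_def X_tau_eq)
    then have "inv\<^bsub>PSL2\<^esub> (psl A) \<otimes>\<^bsub>PSL2\<^esub> psl B \<in> generate PSL2 (X_tau (pm t))"
      by (intro generate.eng generate.inv generate.incl)
    then show ?thesis using AB by (simp add: P_def inv_psl det_mul)
  qed
  \<comment> \<open>A root of X^2 - t X + 1, so that a triangular matrix with diagonal s, 1/s has
    trace t.\<close>
  define s where "s = (t + csqrt (t\<^sup>2 - 4)) / 2"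
  have "s\<^sup>2 - t * s + 1 = ((csqrt (t\<^sup>2 - 4))\<^sup>2 - (t\<^sup>2 - 4)) / 4"
    by (simp only: s_def power2_eq_square) (simp add: field_simps)
  then have s: "s\<^sup>2 - t * s + 1 = 0" by simp
  then have s0: "s \<noteq> 0" by auto
  then have t: "s + inverse s = t" using s by (simp add: field_simps power2_eq_square)
  \<comment> \<open>Both off-diagonal entries must be nonzero: if s is 1 or -1, a diagonal matrix
    would be scalar and hence outside \<open>Y_t t\<close>.\<close>
  have shift: "\<exists>x. x \<noteq> 0 \<and> x + w \<noteq> 0" for w :: complex
    by (cases "w = - 1") (auto simp: add_eq_0_iff intro: exI[of _ "1 :: complex"] exI[of _ "2 :: complex"])
  have low: "P (mat2 1 0 v 1)" for v
  proof -
    obtain x where x: "x \<noteq> 0" "x + v / s \<noteq> 0" using shift by blast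
    have "P (adj2 (mat2 s 0 x (inverse s)) ** mat2 s 0 (x + v / s) (inverse s))"
      using s0 t x by (intro quot) (auto simp: Y_t_def mat2_one)
    then show ?thesis using s0 by (simp add: field_simps)
  qed
  have up: "P (mat2 1 v 0 1)" for v
  proof -
    obtain x where x: "x \<noteq> 0" "x + v * s \<noteq> 0" using shift by blast
    have "P (adj2 (mat2 s x 0 (inverse s)) ** mat2 s (x + v * s) 0 (inverse s))"
      using s0 t x by (intro quot) (auto simp: Y_t_def mat2_one)
    then show ?thesis using s0 by (simp add: field_simps)
  qed
  have "P A" if "det A = 1" for A
    using mult up low that by (rule SL2_elementary_induct)
  then show "carrier PSL2 \<subseteq> generate PSL2 (X_tau (pm t))"
    by (auto simp: carrier_PSL2 P_def)
qed


section \<open>Centralizers\<close>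

text \<open>Commuting in \<open>PSL2\<close> means commuting up to sign. An A that anticommutes with
  F conjugates F to -F, so it can occur only if F has trace 0.\<close>

lemma centralizer_psl:
  assumes "det F = 1"
  shows "centralizer PSL2 (psl F) = psl ` {A. det A = 1 \<and> (F ** A = A ** F \<or> F ** A = - (A ** F))}"
  using assms by (auto simp: centralizer_def carrier_PSL2 psl_eq_iff psl_uminus)

lemma lft_S_mat2: "s \<noteq> 0 \<Longrightarrow> lft_S (s\<^sup>2) = psl (mat2 s 0 0 (inverse s))"
  and lft_S'_mat2: "s \<noteq> 0 \<Longrightarrow> lft_S' (s\<^sup>2) = psl (mat2 0 (- s) (inverse s) 0)"
  and lft_T_mat2: "lft_T v = psl (mat2 1 v 0 1)"
  by (simp_all add: lft_S_eq lft_S'_eq lft_T_eq mat2_def)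

text \<open>The matrix of z \<mapsto> \<lambda> z needs a square root of \<lambda>. As every nonzero
  number is a square, the multipliers can be reparametrized by the root.\<close>

lemma image_nonzero_squares: "g ` (- {0}) = (\<lambda>s. g (s\<^sup>2)) ` (- {0 :: complex})"
proof -
  have "- {0 :: complex} = (\<lambda>s. s\<^sup>2) ` (- {0})"
  proof (intro subset_antisym subsetI)
    fix x :: complex assume "x \<in> - {0}"
    then show "x \<in> (\<lambda>s. s\<^sup>2) ` (- {0})" by (intro image_eqI[of _ _ "csqrt x"]) auto
  qed auto
  then show ?thesis by (metis image_image)
qed

lemma image_lft_S: "lft_S ` (- {0}) = (\<lambda>s. psl (mat2 s 0 0 (inverse s))) ` (- {0})"
  and image_lft_S': "lft_S' ` (- {0}) = (\<lambda>s. psl (mat2 0 (- s) (inverse s) 0)) ` (- {0})"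
  by (subst image_nonzero_squares, rule image_cong; simp add: lft_S_mat2 lft_S'_mat2)+

lemma centralizer_T: "centralizer PSL2 (lft_T 1) = range lft_T"
proof -
  have "psl A \<in> range lft_T"
    if A: "det A = 1" and c: "mat2 1 1 0 1 ** A = A ** mat2 1 1 0 1 \<or>
      mat2 1 1 0 1 ** A = - (A ** mat2 1 1 0 1)" for A
  proof -
    obtain a b c d where abcd: "A = mat2 a b c d" by (rule mat2_cases)
    have "c = 0" "a = d" using A c by (auto simp: abcd eq_neg_iff_add_eq_0)
    moreover from this have "a = 1 \<or> a = - 1" using A by (simp add: abcd square_eq_1_iff)
    ultimately have "psl A = lft_T (b / a)" by (auto simp: lft_T_mat2 psl_eq_iff abcd)
    then show ?thesis by blast
  qed
  moreover have "range lft_T \<subseteq> centralizer PSL2 (lft_T 1)"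
    by (auto simp: lft_T_mat2 centralizer_psl intro!: imageI)
  ultimately show ?thesis
    by (auto simp: lft_T_mat2[of 1] centralizer_psl)
qed

text \<open>The eigenvalues s and 1/s are distinct, so the commuting matrices are diagonal. The
  anticommuting ones are antidiagonal and exist only when s + 1/s = 0.\<close>

lemma centralizer_S:
  assumes s: "s \<noteq> 0" "s\<^sup>2 \<noteq> 1"
  shows "centralizer PSL2 (lft_S (s\<^sup>2)) =
    (if s + inverse s = 0 then lft_S ` (- {0}) \<union> lft_S' ` (- {0}) else lft_S ` (- {0}))"
    (is "_ = ?H")
proof
  let ?F = "mat2 s 0 0 (inverse s)"
  have s1: "s \<noteq> inverse s" using s by (auto simp: field_simps power2_eq_square)
  show "centralizer PSL2 (lft_S (s\<^sup>2)) \<subseteq> ?H"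
  proof
    fix x assume "x \<in> centralizer PSL2 (lft_S (s\<^sup>2))"
    then obtain A where A: "det A = 1" "x = psl A" "?F ** A = A ** ?F \<or> ?F ** A = - (A ** ?F)"
      using s by (auto simp: lft_S_mat2 centralizer_psl)
    obtain a b c d where abcd: "A = mat2 a b c d" by (rule mat2_cases)
    from A(3) show "x \<in> ?H"
    proof
      assume "?F ** A = A ** ?F"
      then have "b = 0" "c = 0" using s1 by (auto simp: abcd mult.commute)
      then have "a \<noteq> 0" "d = inverse a" using A(1) by (auto simp: abcd inverse_unique)
      then have "x \<in> lft_S ` (- {0})"
        unfolding image_lft_S A(2) abcd using \<open>b = 0\<close> \<open>c = 0\<close> by blast
      then show ?thesis by auto
    next
      assume "?F ** A = - (A ** ?F)"
      then have e: "s * a = 0" "b * (s + inverse s) = 0" "c * (s + inverse s) = 0" "d = 0"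
        using s by (auto simp: abcd algebra_simps eq_neg_iff_add_eq_0)
      then have ad: "a = 0" "d = 0" using s by auto
      then have bc: "b * c = - 1" using A(1) by (simp add: abcd) (metis minus_minus)
      then have "b \<noteq> 0" by auto
      then have t: "s + inverse s = 0" "c = inverse (- b)"
        using e(2) bc inverse_unique[of "- b" c] by simp_all
      then have "x = psl (mat2 0 (- (- b)) (inverse (- b)) 0)" by (simp add: A(2) abcd ad)
      then have "x \<in> lft_S' ` (- {0})"
        unfolding image_lft_S' using \<open>b \<noteq> 0\<close> by (intro image_eqI[of _ _ "- b"]) auto
      then show ?thesis using t by simp
    qed
  qed
  show "?H \<subseteq> centralizer PSL2 (lft_S (s\<^sup>2))"
  proof -
    have "inverse s = - s" if "s + inverse s = 0"
      using that by (simp add: eq_neg_iff_add_eq_0 add.commute)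
    then show ?thesis
      using s by (auto simp: lft_S_mat2 centralizer_psl image_lft_S image_lft_S' mult.commute
          intro!: imageI)
  qed
qed

section \<open>The base points \<open>f_tau\<close>\<close>

lemma pm_eq_iff: "pm t = pm u \<longleftrightarrow> t = u \<or> t = - u"
  by (auto simp: pm_def doubleton_eq_iff)

text \<open>Whichever representative and angle are chosen, \<lambda>_t is an eigenvalue of the
  matrices of trace t.\<close>

lemma is_lambda_sum:
  assumes "is_lambda t l"
  shows "l \<noteq> 0" "t = l + inverse l"
proof -
  have "exp (\<i> * of_real \<theta>) + inverse (exp (\<i> * of_real \<theta>)) = of_real (2 * cos \<theta>)" for \<theta> :: real
    by (simp add: cis_conv_exp[symmetric] cis_inverse complex_eq_iff)
  then show "l \<noteq> 0" "t = l + inverse l" using assms unfolding is_lambda_def by auto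
qed

lemma
  assumes \<tau>: "\<tau> \<in> \<T>" and l: "\<tau> \<noteq> pm 2 \<Longrightarrow> t \<in> \<tau> \<and> is_lambda t (l \<tau>)"
  shows f_tau_in_X_tau: "f_tau l \<tau> \<in> X_tau \<tau>"
    and centralizer_f_tau: "centralizer PSL2 (f_tau l \<tau>) = H_tau \<tau>"
proof -
  have "f_tau l \<tau> \<in> X_tau \<tau> \<and> centralizer PSL2 (f_tau l \<tau>) = H_tau \<tau>"
  proof (cases "\<tau> = pm 2")
    case True
    have "lft_T 1 \<in> X_tau (pm 2)"
      by (auto simp: X_tau_eq lft_T_mat2 Y_t_def mat2_one intro!: imageI)
    then show ?thesis using True by (simp add: f_tau_def H_tau_def centralizer_T)
  next
    case False
    let ?s = "l \<tau>"
    have t: "t \<in> \<tau>" "?s \<noteq> 0" "t = ?s + inverse ?s" using l[OF False] is_lambda_sum by auto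
    obtain u where "\<tau> = pm u" using \<tau> by (auto simp: \<T>_def)
    then have \<tau>t: "\<tau> = pm t" using t(1) by (auto simp: pm_def)
    \<comment> \<open>\<lambda>_t = 1 or -1 would give trace 2 or -2, hence \<tau> = [2].\<close>
    have s: "?s\<^sup>2 \<noteq> 1"
    proof
      assume "?s\<^sup>2 = 1"
      then have "?s = 1 \<or> ?s = - 1" by (simp add: power2_eq_1_iff)
      then have "t = 2 \<or> t = - 2" by (elim disjE) (simp_all add: t(3))
      then show False using False by (simp add: \<tau>t pm_eq_iff)
    qed
    then have "mat2 ?s 0 0 (inverse ?s) \<in> Y_t t"
      using t by (auto simp: Y_t_def mat2_one)
    then have "psl (mat2 ?s 0 0 (inverse ?s)) \<in> X_tau \<tau>"
      by (subst \<tau>t) (simp add: X_tau_eq)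
    then have "f_tau l \<tau> \<in> X_tau \<tau>"
      using False t(2) by (simp add: f_tau_def lft_S_mat2)
    moreover have "\<tau> = pm 0 \<longleftrightarrow> ?s + inverse ?s = 0"
      unfolding t(3)[symmetric] by (simp add: \<tau>t pm_eq_iff)
    then have "H_tau \<tau> = (if ?s + inverse ?s = 0 then lft_S ` (- {0}) \<union> lft_S' ` (- {0})
        else lft_S ` (- {0}))"
      using False by (simp add: H_tau_def)
    ultimately show ?thesis
      using False centralizer_S[OF t(2) s] by (simp add: f_tau_def)
  qed
  then show "f_tau l \<tau> \<in> X_tau \<tau>" "centralizer PSL2 (f_tau l \<tau>) = H_tau \<tau>" by auto
qed

section \<open>The topology of \<open>PSL2\<close>\<close>

lemma continuous_on_matrix_mult [continuous_intros]:
  fixes f :: "'a::topological_space \<Rightarrow> complex^2^2"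
  assumes "continuous_on S f" "continuous_on S g"
  shows "continuous_on S (\<lambda>x. f x ** g x)"
  unfolding matrix_matrix_mult_def by (intro continuous_intros assms)

lemma mat2_vec_lambda:
  "mat2 a b c d = (\<chi> i j. if i = 1 then if j = 1 then a else b else if j = 1 then c else d)"
  by (simp add: mat2_eq_iff)

lemma continuous_on_mat2 [continuous_intros]:
  fixes a b c d :: "'a::topological_space \<Rightarrow> complex"
  assumes "continuous_on S a" "continuous_on S b" "continuous_on S c" "continuous_on S d"
  shows "continuous_on S (\<lambda>x. mat2 (a x) (b x) (c x) (d x))"
proof -
  have "continuous_on S (\<lambda>x. if i = 1 then if j = 1 then a x else b x else if j = 1 then c x else d x)"
    for i j :: 2
    using assms by (cases "i = 1"; cases "j = 1") simp_all
  then show ?thesis unfolding mat2_vec_lambda by (intro continuous_intros)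
qed

lemma continuous_on_adj2 [continuous_intros]:
  fixes f :: "'a::topological_space \<Rightarrow> complex^2^2"
  shows "continuous_on S f \<Longrightarrow> continuous_on S (\<lambda>x. adj2 (f x))"
  unfolding adj2_def by (intro continuous_intros)

lemma continuous_on_trace [continuous_intros]:
  fixes f :: "'a::topological_space \<Rightarrow> complex^2^2"
  shows "continuous_on S f \<Longrightarrow> continuous_on S (\<lambda>x. trace (f x))"
  unfolding trace_2 by (intro continuous_intros)

lemma topspace_quotient_topology: "topspace (quotient_topology X f) = f ` topspace X"
  using quotient_map_quotient_topology[of X f] by (simp add: quotient_map_def)

lemma topspace_PSL2 [simp]: "topspace PSL2_topology = carrier PSL2"
  by (simp add: PSL2_topology_def topspace_quotient_topology carrier_PSL2)

lemma quotient_map_psl: "quotient_map (top_of_set (carrier SL2)) PSL2_topology psl"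
  unfolding PSL2_topology_def by (rule quotient_map_quotient_topology)

text \<open>The saturation of a set U is the union of U and -U, which is open when U is.\<close>

lemma open_map_psl: "open_map (top_of_set (carrier SL2)) PSL2_topology psl"
  unfolding open_map_def
proof (intro allI impI)
  fix U assume "openin (top_of_set (carrier SL2)) U"
  then obtain T where T: "open T" "U = carrier SL2 \<inter> T" by (auto simp: openin_open)
  have "{A \<in> carrier SL2. psl A \<in> psl ` U} = carrier SL2 \<inter> (T \<union> uminus ` T)"
  proof -
    have "psl A \<in> psl ` U \<longleftrightarrow> A \<in> T \<or> A \<in> uminus ` T" if A: "det A = 1" for A
    proof -
      have "psl A \<in> psl ` U \<longleftrightarrow> A \<in> U \<or> - A \<in> U"
        by (auto simp: image_iff psl_eq_iff) (metis minus_minus)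
      also have "\<dots> \<longleftrightarrow> A \<in> T \<or> A \<in> uminus ` T"
        using A by (auto simp: T(2) det_uminus2 image_iff) (metis minus_minus)
      finally show ?thesis .
    qed
    then show ?thesis by auto
  qed
  moreover have "open (T \<union> uminus ` T)" using T(1) by (intro open_Un open_negations)
  ultimately have "openin (top_of_set (carrier SL2)) {A \<in> carrier SL2. psl A \<in> psl ` U}"
    by (auto simp: openin_open)
  then show "openin PSL2_topology (psl ` U)"
    using T(2) by (auto simp: PSL2_topology_def openin_quotient_topology)
qed

lemma topspace_X_tau [simp]:
  "topspace (subtopology PSL2_topology (X_tau (pm t))) = X_tau (pm t)"
  using X_tau_subset by auto

lemma Y_t_subset: "Y_t t \<subseteq> carrier SL2"
  by (auto simp: Y_t_def)

lemma continuous_map_psl_Y_t: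
  "continuous_map (top_of_set (Y_t t)) (subtopology PSL2_topology (X_tau (pm t))) psl"
proof (rule continuous_map_into_subtopology)
  have "top_of_set (Y_t t) = subtopology (top_of_set (carrier SL2)) (Y_t t)"
    using Y_t_subset[of t] by (simp add: subtopology_subtopology inf_absorb2)
  then show "continuous_map (top_of_set (Y_t t)) PSL2_topology psl"
    using quotient_imp_continuous_map[OF quotient_map_psl] continuous_map_from_subtopology by metis
qed (auto simp: X_tau_eq)

text \<open>An open map need not stay open on a subset that is not saturated, and for nonzero t the
  preimage of the class also contains \<open>Y_t (- t)\<close>. The open condition \<open>V\<close>
  excludes that second sheet; for t = 0 there is none and \<open>V\<close> is everything.\<close>

lemma open_map_psl_Y_t:
  "open_map (top_of_set (Y_t t)) (subtopology PSL2_topology (X_tau (pm t))) psl"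
  unfolding open_map_def
proof (intro allI impI)
  fix U assume "openin (top_of_set (Y_t t)) U"
  then obtain T where T: "open T" "U = Y_t t \<inter> T" by (auto simp: openin_open)
  define V where "V = {A :: complex^2^2. t = 0 \<or> trace A \<noteq> - t}"
  have "V = (if t = 0 then UNIV else {A. trace A \<noteq> - t})" by (auto simp: V_def)
  then have "open V" by (auto intro!: open_Collect_neq continuous_intros)
  have "psl ` U = psl ` (carrier SL2 \<inter> (T \<inter> V)) \<inter> X_tau (pm t)"
  proof
    show "psl ` U \<subseteq> psl ` (carrier SL2 \<inter> (T \<inter> V)) \<inter> X_tau (pm t)"
      by (auto simp: T(2) X_tau_eq Y_t_def V_def)
    show "psl ` (carrier SL2 \<inter> (T \<inter> V)) \<inter> X_tau (pm t) \<subseteq> psl ` U"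
    proof
      fix x assume "x \<in> psl ` (carrier SL2 \<inter> (T \<inter> V)) \<inter> X_tau (pm t)"
      then obtain A B where A: "det A = 1" "A \<in> T" "A \<in> V" "x = psl A"
        and B: "B \<in> Y_t t" "x = psl B" by (auto simp: X_tau_eq)
      have "A = B \<or> A = - B" using A(4) B(2) psl_eq_iff by metis
      then have "A \<in> Y_t t"
        using A(3) B(1) by (auto simp: V_def Y_t_def trace_uminus det_uminus2 minus_equation_iff[of B])
      then show "x \<in> psl ` U" using A by (auto simp: T(2))
    qed
  qed
  moreover have "openin PSL2_topology (psl ` (carrier SL2 \<inter> (T \<inter> V)))"
    using open_map_psl T(1) \<open>open V\<close> by (simp add: open_map_def openin_open_Int open_Int)
  ultimately show "openin (subtopology PSL2_topology (X_tau (pm t))) (psl ` U)"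
    by (auto simp: openin_subtopology)
qed

lemma quotient_map_psl_Y_t:
  "quotient_map (top_of_set (Y_t t)) (subtopology PSL2_topology (X_tau (pm t))) psl"
  using continuous_map_psl_Y_t open_map_psl_Y_t
  by (rule continuous_open_imp_quotient_map) (simp add: X_tau_eq[symmetric] del: topspace_subtopology)

lemma uminus_in_Y_t: "A \<in> Y_t t \<Longrightarrow> - A \<in> Y_t (- t)"
  unfolding Y_t_def by (simp add: det_uminus2 trace_uminus) (metis minus_minus)

section \<open>Second countability and separation\<close>

lemma second_countable_euclidean:
  "second_countable (euclidean :: 'a::second_countable_topology topology)"
proof -
  obtain \<B> :: "'a set set" where "countable \<B>" "topological_basis \<B>"
    using ex_countable_basis by blast
  then show ?thesis
    unfolding second_countable_def by (metis open_openin topological_basisE topological_basis_open)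
qed

lemma second_countable_X_tau: "second_countable (subtopology PSL2_topology (X_tau (pm t)))"
  using continuous_map_psl_Y_t open_map_psl_Y_t
  by (rule second_countable_open_map_image)
    (simp_all add: X_tau_eq[symmetric] second_countable_subtopology second_countable_euclidean
      del: topspace_subtopology)

text \<open>Induces a continuous injection of \<open>PSL2\<close> into a Euclidean space.\<close>

definition tensor_square :: "complex^2^2 \<Rightarrow> complex^2^2^2^2"
  where "tensor_square A = (\<chi> i j k l. A$i$j * A$k$l)"

text \<open>Its square fixes a nonzero entry up to sign, and the products with that entry then fix
  all others with the same sign.\<close>

lemma tensor_square_eq_iff: "tensor_square A = tensor_square B \<longleftrightarrow> A = B \<or> A = - B"
proof
  assume "tensor_square A = tensor_square B"
  then have e: "A$i$j * A$k$l = B$i$j * B$k$l" for i j k l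
    by (simp add: tensor_square_def vec_eq_iff)
  show "A = B \<or> A = - B"
  proof (cases "A = 0")
    case True
    then have "B$i$j = 0" for i j using e[of i j i j] by simp
    then show ?thesis using True by (simp add: vec_eq_iff)
  next
    case False
    then obtain i j where ij: "A$i$j \<noteq> 0" by (auto simp: vec_eq_iff)
    have "B$i$j = A$i$j \<or> B$i$j = - A$i$j"
      using e[of i j i j] square_eq_iff[of "B$i$j" "A$i$j"] by simp
    then show ?thesis
    proof
      assume *: "B$i$j = A$i$j"
      then have "A$k$l = B$k$l" for k l using e[of i j k l] ij by simp
      then show ?thesis by (simp add: vec_eq_iff)
    next
      assume *: "B$i$j = - A$i$j"
      then have "A$i$j * A$k$l = A$i$j * (- B$k$l)" for k l using e[of i j k l] by simp
      then have "A$k$l = - B$k$l" for k l using ij mult_left_cancel by blast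
      then show ?thesis by (simp add: vec_eq_iff)
    qed
  qed
qed (auto simp: tensor_square_def vec_eq_iff)

lemma Hausdorff_PSL2: "Hausdorff_space PSL2_topology"
proof -
  define f where "f x = tensor_square (SOME A. A \<in> x)" for x
  have f: "f (psl A) = tensor_square A" for A
  proof -
    have "(SOME B. B \<in> psl A) \<in> psl A" by (rule someI[of _ A]) (simp add: psl_eq)
    then show ?thesis by (auto simp: f_def psl_eq tensor_square_eq_iff)
  qed
  have "continuous_on (carrier SL2) tensor_square"
    unfolding tensor_square_def by (intro continuous_intros)
  then have "continuous_map (top_of_set (carrier SL2)) euclidean (f \<circ> psl)"
    by (simp add: f comp_def continuous_map_iff_continuous)
  then have "continuous_map PSL2_topology euclidean f"
    by (rule continuous_compose_quotient_map[OF quotient_map_psl])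
  moreover have "inj_on f (topspace PSL2_topology)"
    by (auto simp: inj_on_def carrier_PSL2 f tensor_square_eq_iff psl_eq_iff)
  ultimately show ?thesis
    by (rule Hausdorff_space_injective_preimage[OF Hausdorff_space_euclidean])
qed


section \<open>The coset space\<close>

text \<open>The right half-plane avoids the nonpositive reals, the branch cut of
  \<open>csqrt\<close>, and is disjoint from its negative; a merely nonzero entry would give neither
  property.\<close>

definition Y_chart :: "complex \<Rightarrow> complex^2^2 \<Rightarrow> (complex^2^2) set"
  where "Y_chart t g = {A \<in> Y_t t. Re ((g ** A ** adj2 g)$1$2) > 0}"

lemma Y_chart_cover:
  assumes "A \<in> Y_t t"
  obtains g where "det g = 1" "A \<in> Y_chart t g"
  using nonscalar_conj_upper_entry[of A] assms by (auto simp: Y_chart_def Y_t_def)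

lemma openin_Y_chart: "openin (top_of_set (Y_t t)) (Y_chart t g)"
proof -
  have "open {A. Re ((g ** A ** adj2 g)$1$2) > 0}"
    by (intro open_Collect_less continuous_intros)
  then show ?thesis by (auto simp: openin_open Y_chart_def)
qed

text \<open>A continuous surjection onto \<open>Y_t t\<close> with continuous local sections over an
  open cover is a quotient map: openness of U can be tested by pulling the preimage of U back along
  a section.\<close>

lemma quotient_map_Y_t:
  assumes F: "F \<in> Y_t t"
  shows "quotient_map (top_of_set (carrier SL2)) (top_of_set (Y_t t)) (\<lambda>A. adj2 A ** F ** A)"
    (is "quotient_map ?SL ?Y ?p")
  unfolding quotient_map_def
proof (intro conjI allI impI iffI)
  have cont: "continuous_on (carrier SL2) ?p" by (intro continuous_intros)
  have into: "?p ` carrier SL2 \<subseteq> Y_t t" using Y_t_conj[OF F] by auto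
  have "M \<in> ?p ` carrier SL2" if M: "M \<in> Y_t t" for M
  proof -
    obtain S where "det S = 1" "?p S = M" using F M by (rule Y_t_transitive)
    then show ?thesis by (intro image_eqI[of _ _ S]) simp_all
  qed
  then show "?p ` topspace ?SL = topspace ?Y" using into by auto
  fix U assume U: "U \<subseteq> topspace ?Y"
  {
    assume "openin ?Y U"
    then have "openin ?SL (carrier SL2 \<inter> ?p -` U)"
      using continuous_openin_preimage[OF cont] into by (auto simp: Pi_iff)
    then show "openin ?SL {x \<in> topspace ?SL. ?p x \<in> U}"
      by (simp add: vimage_def Int_def)
  }
  assume op: "openin ?SL {x \<in> topspace ?SL. ?p x \<in> U}"
  obtain R where R: "det R = 1" "adj2 R ** companion t ** R = F"
    using F by (rule Y_t_conj_companion)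
  have RF: "companion t = R ** F ** adj2 R"
    using R by (metis adj2_inverse(2) matrix_mul_assoc matrix_mul_lid matrix_mul_rid)
  have "\<exists>V. openin ?Y V \<and> y \<in> V \<and> V \<subseteq> U" if "y \<in> U" for y
  proof -
    have "y \<in> Y_t t" using U that by auto
    then obtain g where g: "det g = 1" "y \<in> Y_chart t g" by (rule Y_chart_cover)
    \<comment> \<open>The local section: g moves M into the region where \<open>to_companion\<close>
      is continuous, and the fixed R leads from the companion matrix to F.\<close>
    define S where "S M = adj2 R ** to_companion (g ** M ** adj2 g) ** g" for M
    have csq: "continuous_on (Y_chart t g) (\<lambda>M. csqrt ((g ** M ** adj2 g)$1$2))"
      by (rule continuous_on_compose2[OF continuous_on_csqrt])
        (auto simp: Y_chart_def complex_nonpos_Reals_iff intro!: continuous_intros)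
    have "continuous_on (Y_chart t g) S"
      unfolding S_def to_companion_def Let_def
      by (intro continuous_intros csq) (auto simp: Y_chart_def)
    moreover have S: "det (S M) = 1 \<and> ?p (S M) = M" if M: "M \<in> Y_chart t g" for M
    proof -
      let ?N = "g ** M ** adj2 g" and ?Q = "to_companion (g ** M ** adj2 g)"
      have "det M = 1" "trace M = t" using M by (auto simp: Y_chart_def Y_t_def)
      then have N: "det ?N = 1" "trace ?N = t" "?N$1$2 \<noteq> 0"
        using M g trace_mul_sym[of g "M ** adj2 g"]
        by (auto simp: det_mul adj2_inverse matrix_mul_assoc[symmetric] Y_chart_def)
      note Q = to_companion[OF N(1,3), unfolded N(2)]
      have adj: "adj2 (S M) = adj2 g ** adj2 ?Q ** R"
        by (simp add: S_def mat2_eq_iff adj2_def matrix_matrix_mult_def sum_2 algebra_simps)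
      have "?p (S M) = adj2 g ** (adj2 ?Q ** (R ** F ** adj2 R) ** ?Q) ** g"
        unfolding adj by (simp add: S_def matrix_mul_assoc)
      also have "\<dots> = (adj2 g ** g) ** M ** (adj2 g ** g)"
        unfolding RF[symmetric] Q(2) by (simp add: matrix_mul_assoc)
      also have "\<dots> = M" using g by (simp add: adj2_inverse)
      finally show ?thesis using R g Q by (simp add: S_def det_mul)
    qed
    ultimately have "openin (top_of_set (Y_chart t g)) (Y_chart t g \<inter> S -` {x \<in> topspace ?SL. ?p x \<in> U})"
      using continuous_openin_preimage[OF _ _ op, of "Y_chart t g" S] by (auto simp: Pi_iff)
    \<comment> \<open>\<open>S\<close> is a section of the orbit map, so pulling back along both
      returns U within the chart domain.\<close>
    also have "Y_chart t g \<inter> S -` {x \<in> topspace ?SL. ?p x \<in> U} = Y_chart t g \<inter> U"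
      using S by auto
    finally have "openin ?Y (Y_chart t g \<inter> U)"
      using openin_Y_chart openin_trans by blast
    then show ?thesis using g that by (intro exI[of _ "Y_chart t g \<inter> U"]) auto
  qed
  then show "openin ?Y U" by (subst openin_subopen) blast
qed

lemma quotient_maps_same_fibres_homeomorphic:
  assumes f: "quotient_map X Y f" and g: "quotient_map X Z g"
    and fib: "\<And>x y. \<lbrakk>x \<in> topspace X; y \<in> topspace X\<rbrakk> \<Longrightarrow> f x = f y \<longleftrightarrow> g x = g y"
  shows "Y homeomorphic_space Z"
proof -
  obtain u where u: "continuous_map Y Z u" "\<And>x. x \<in> topspace X \<Longrightarrow> u (f x) = g x"
    using quotient_map_lift_exists[OF f quotient_imp_continuous_map[OF g]] fib by metis
  obtain v where v: "continuous_map Z Y v" "\<And>x. x \<in> topspace X \<Longrightarrow> v (g x) = f x"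
    using quotient_map_lift_exists[OF g quotient_imp_continuous_map[OF f]] fib by metis
  have "topspace Y = f ` topspace X" "topspace Z = g ` topspace X"
    using f g by (auto simp: quotient_map_def)
  then have "homeomorphic_maps Y Z u v" using u v by (auto simp: homeomorphic_maps_def)
  then show ?thesis by (auto simp: homeomorphic_space_def)
qed

text \<open>The orbit map and the coset projection are quotient maps on \<open>PSL2\<close> with the
  same fibres.\<close>

lemma X_tau_homeomorphic_cosets:
  assumes f: "f \<in> X_tau (pm t)"
  shows "subtopology PSL2_topology (X_tau (pm t)) homeomorphic_space
    coset_topology (centralizer PSL2 f)"
proof (rule quotient_maps_same_fibres_homeomorphic)
  let ?c = "\<lambda>g. inv\<^bsub>PSL2\<^esub> g \<otimes>\<^bsub>PSL2\<^esub> f \<otimes>\<^bsub>PSL2\<^esub> g"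
    and ?X = "subtopology PSL2_topology (X_tau (pm t))"
  obtain F where F: "F \<in> Y_t t" "f = psl F" using f by (auto simp: X_tau_eq)
  \<comment> \<open>The route from \<open>SL2\<close> through \<open>Y_t t\<close> equals the route
    through \<open>PSL2\<close>. As the composite is a quotient map, so is its second factor on
    \<open>PSL2\<close>, the orbit map.\<close>
  have "quotient_map (top_of_set (carrier SL2)) ?X (psl \<circ> (\<lambda>A. adj2 A ** F ** A))"
    using quotient_map_Y_t[OF F(1)] quotient_map_psl_Y_t by (rule quotient_map_compose)
  then have q: "quotient_map (top_of_set (carrier SL2)) ?X (?c \<circ> psl)"
    by (rule quotient_map_eq) (use F in \<open>auto simp: conj_psl Y_t_def\<close>)
  show "quotient_map PSL2_topology ?X ?c"
  proof (rule quotient_map_from_composition[OF _ _ q])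
    show "continuous_map (top_of_set (carrier SL2)) PSL2_topology psl"
      by (rule quotient_imp_continuous_map[OF quotient_map_psl])
    show "continuous_map PSL2_topology ?X ?c"
      using quotient_imp_continuous_map[OF q] by (rule continuous_compose_quotient_map[OF quotient_map_psl])
  qed
  show "quotient_map PSL2_topology (coset_topology (centralizer PSL2 f))
      (\<lambda>g. centralizer PSL2 f #>\<^bsub>PSL2\<^esub> g)"
    unfolding coset_topology_def by (rule quotient_map_quotient_topology)
  show "?c x = ?c y \<longleftrightarrow> centralizer PSL2 f #>\<^bsub>PSL2\<^esub> x = centralizer PSL2 f #>\<^bsub>PSL2\<^esub> y"
    if "x \<in> topspace PSL2_topology" "y \<in> topspace PSL2_topology" for x y
    using that f X_tau_subset by (intro PSL2.conj_eq_iff_centralizer) auto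
qed

section \<open>Complex charts\<close>

text \<open>The scalar counterpart of the condition in \<open>holomorphic_vec_on\<close>: functions
  with values in the complex numbers can be multiplied and divided, which yields all rational
  functions.\<close>

definition complex_diff_at :: "(complex^'n \<Rightarrow> complex) \<Rightarrow> complex^'n \<Rightarrow> bool"
  where "complex_diff_at f x \<longleftrightarrow> (\<exists>D. (f has_derivative D) (at x) \<and> (\<forall>c v. D (c *s v) = c * D v))"

lemma complex_diff_const: "complex_diff_at (\<lambda>v. c) x"
  unfolding complex_diff_at_def by (intro exI[of _ "\<lambda>_. 0"]) auto

lemma complex_diff_component: "complex_diff_at (\<lambda>v. v$i) x"
  unfolding complex_diff_at_def
  by (intro exI[of _ "\<lambda>v. v$i"]) (auto intro: bounded_linear_imp_has_derivative bounded_linear_vec_nth)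

lemma complex_diff_add:
  assumes "complex_diff_at f x" "complex_diff_at g x"
  shows "complex_diff_at (\<lambda>v. f v + g v) x"
proof -
  obtain D E where "(f has_derivative D) (at x)" "\<forall>c v. D (c *s v) = c * D v"
    "(g has_derivative E) (at x)" "\<forall>c v. E (c *s v) = c * E v"
    using assms by (auto simp: complex_diff_at_def)
  then show ?thesis unfolding complex_diff_at_def
    by (intro exI[of _ "\<lambda>v. D v + E v"]) (auto intro: has_derivative_add simp: distrib_left)
qed

lemma complex_diff_mult:
  assumes "complex_diff_at f x" "complex_diff_at g x"
  shows "complex_diff_at (\<lambda>v. f v * g v) x"
proof -
  obtain D E where "(f has_derivative D) (at x)" "\<forall>c v. D (c *s v) = c * D v"
    "(g has_derivative E) (at x)" "\<forall>c v. E (c *s v) = c * E v"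
    using assms by (auto simp: complex_diff_at_def)
  then show ?thesis unfolding complex_diff_at_def
    by (intro exI[of _ "\<lambda>v. f x * E v + D v * g x"] conjI has_derivative_mult)
      (auto simp: algebra_simps)
qed

lemma complex_diff_uminus: "complex_diff_at f x \<Longrightarrow> complex_diff_at (\<lambda>v. - f v) x"
  using complex_diff_mult[OF complex_diff_const[of "- 1"]] by fastforce

lemma complex_diff_diff:
  "\<lbrakk>complex_diff_at f x; complex_diff_at g x\<rbrakk> \<Longrightarrow> complex_diff_at (\<lambda>v. f v - g v) x"
  using complex_diff_add[OF _ complex_diff_uminus] by fastforce

lemma complex_diff_inverse:
  assumes "complex_diff_at f x" "f x \<noteq> 0"
  shows "complex_diff_at (\<lambda>v. inverse (f v)) x"
proof -
  obtain D where "(f has_derivative D) (at x)" "\<forall>c v. D (c *s v) = c * D v"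
    using assms by (auto simp: complex_diff_at_def)
  then show ?thesis unfolding complex_diff_at_def using assms(2)
    by (intro exI[of _ "\<lambda>v. - (inverse (f x) * D v * inverse (f x))"])
      (auto intro: has_derivative_inverse)
qed

lemma complex_diff_divide:
  "\<lbrakk>complex_diff_at f x; complex_diff_at g x; g x \<noteq> 0\<rbrakk> \<Longrightarrow> complex_diff_at (\<lambda>v. f v / g v) x"
  unfolding divide_inverse by (intro complex_diff_mult complex_diff_inverse)

lemma complex_diff_matrix_mult:
  fixes M N :: "complex^'n \<Rightarrow> complex^2^2"
  assumes "\<And>i j. complex_diff_at (\<lambda>v. M v $ i $ j) x" "\<And>i j. complex_diff_at (\<lambda>v. N v $ i $ j) x"
  shows "complex_diff_at (\<lambda>v. (M v ** N v) $ i $ j) x"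
  by (simp add: matrix_matrix_mult_def sum_2 complex_diff_add complex_diff_mult assms)

lemma complex_diff_vector:
  assumes "complex_diff_at f x" "complex_diff_at g x"
  shows "\<exists>D. ((\<lambda>v. vector [f v, g v] :: complex^2) has_derivative D) (at x) \<and> (\<forall>c v. D (c *s v) = c *s D v)"
proof -
  obtain D E where D: "(f has_derivative D) (at x)" "\<forall>c v. D (c *s v) = c * D v"
    and E: "(g has_derivative E) (at x)" "\<forall>c v. E (c *s v) = c * E v"
    using assms by (auto simp: complex_diff_at_def)
  have bl: "bounded_linear (\<lambda>z. vector [z, 0] :: complex^2)" "bounded_linear (\<lambda>z. vector [0, z] :: complex^2)"
    by (intro linear_conv_bounded_linear[THEN iffD1] linearI; simp add: vec_eq_iff forall_2)+
  have eq: "(\<lambda>v. vector [f v, g v]) = (\<lambda>v. vector [f v, 0] + (vector [0, g v] :: complex^2))"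
    by (simp add: fun_eq_iff vec_eq_iff forall_2)
  have "((\<lambda>v. vector [f v, g v] :: complex^2) has_derivative
      (\<lambda>v. vector [D v, 0] + vector [0, E v])) (at x)"
    unfolding eq
    by (intro has_derivative_add bounded_linear.has_derivative[OF bl(1)]
        bounded_linear.has_derivative[OF bl(2)] D E)
  then show ?thesis using D(2) E(2)
    by (intro exI[of _ "\<lambda>v. vector [D v, 0] + vector [0, E v]"]) (simp add: vec_eq_iff forall_2)
qed

section \<open>Charts of \<open>Y_t\<close> and their inverses\<close>

definition half_space :: "(complex^2) set"
  where "half_space = {v. Re (v$2) > 0}"

definition coords :: "complex^2^2 \<Rightarrow> complex^2^2 \<Rightarrow> complex^2"
  where "coords g A = vector [(g ** A ** adj2 g)$1$1, (g ** A ** adj2 g)$1$2]"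

text \<open>With first row (a, b), trace t forces the lower right entry t - a, and determinant 1
  then forces the lower left entry.\<close>

definition param :: "complex \<Rightarrow> complex^2^2 \<Rightarrow> complex^2 \<Rightarrow> complex^2^2"
  where "param t g v =
    adj2 g ** mat2 (v$1) (v$2) ((v$1 * (t - v$1) - 1) / v$2) (t - v$1) ** g"

lemma open_half_space: "open half_space"
  unfolding half_space_def by (intro open_Collect_less continuous_intros)

lemma conj_adj2_cancel:
  assumes "det g = 1"
  shows "g ** (adj2 g ** N ** g) ** adj2 g = N" "adj2 g ** (g ** N ** adj2 g) ** g = N"
  using assms by (metis adj2_inverse matrix_mul_assoc matrix_mul_lid matrix_mul_rid)+

lemma coords_param: "det g = 1 \<Longrightarrow> coords g (param t g v) = v"
  by (simp add: coords_def param_def conj_adj2_cancel vec_eq_iff forall_2)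

lemma param_in_Y_chart:
  assumes g: "det g = 1" and v: "v \<in> half_space"
  shows "param t g v \<in> Y_chart t g"
proof -
  let ?N = "mat2 (v$1) (v$2) ((v$1 * (t - v$1) - 1) / v$2) (t - v$1)"
  have v2: "v$2 \<noteq> 0" "Re (v$2) > 0" using v by (auto simp: half_space_def)
  then have "?N \<in> Y_t t" by (simp add: Y_t_def mat2_one)
  then have "param t g v \<in> Y_t t" using g unfolding param_def by (rule Y_t_conj)
  then show ?thesis using v2 g by (simp add: Y_chart_def param_def conj_adj2_cancel)
qed

lemma param_coords:
  assumes g: "det g = 1" and A: "A \<in> Y_chart t g"
  shows "param t g (coords g A) = A"
proof -
  obtain a b c d where N: "g ** A ** adj2 g = mat2 a b c d" by (rule mat2_cases)
  have A': "det A = 1" "trace A = t" "Re b > 0"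
    using A N by (auto simp: Y_chart_def Y_t_def)
  have b: "b \<noteq> 0" using A' by auto
  have "det (g ** A ** adj2 g) = 1" "trace (g ** A ** adj2 g) = t"
    using A' g trace_mul_sym[of g "A ** adj2 g"]
    by (simp_all add: det_mul adj2_inverse matrix_mul_assoc[symmetric])
  then have "d = t - a" "a * d - b * c = 1" by (auto simp: N)
  then have c: "(a * d - 1) / b = c" "t - a = d" using b by (auto simp: field_simps)
  have "param t g (coords g A) = adj2 g ** mat2 a b c d ** g"
    by (simp add: param_def coords_def N c)
  then show ?thesis using g by (simp add: N[symmetric] conj_adj2_cancel)
qed

lemma coords_in_half_space: "A \<in> Y_chart t g \<Longrightarrow> coords g A \<in> half_space"
  by (simp add: Y_chart_def half_space_def coords_def)

lemma homeomorphic_maps_coords: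
  assumes g: "det g = 1"
  shows "homeomorphic_maps (top_of_set (Y_chart t g)) (top_of_set half_space) (coords g) (param t g)"
proof -
  have "continuous_on S (coords g)" for S
  proof -
    have "coords g = (\<lambda>A. \<chi> i. (g ** A ** adj2 g)$1$i)"
      by (simp add: coords_def fun_eq_iff vec_eq_iff forall_2)
    then show ?thesis by (simp only:) (intro continuous_intros)
  qed
  moreover have "continuous_on half_space (param t g)"
    unfolding param_def by (intro continuous_intros) (auto simp: half_space_def)
  ultimately show ?thesis
    using param_coords[OF g] coords_param[OF g] param_in_Y_chart[OF g] coords_in_half_space
    by (auto simp: homeomorphic_maps_def)
qed

text \<open>Positivity of the real part of the upper right entry selects one of the matrices \<open>A, -A\<close>;
  this matters only for trace zero, when both lie in \<open>Y_t 0\<close>.\<close>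

lemma inj_on_psl_Y_chart: "inj_on psl (Y_chart t g)"
  by (rule inj_onI) (auto simp: Y_chart_def psl_eq_iff uminus_matrix_mult)

section \<open>Charts of \<open>X_tau\<close>\<close>

definition X_chart :: "complex \<Rightarrow> complex^2^2 \<Rightarrow> (complex^2^2) set \<Rightarrow> complex^2"
  where "X_chart t g x = coords g (inv_into (Y_chart t g) psl x)"

lemma X_chart_psl: "A \<in> Y_chart t g \<Longrightarrow> X_chart t g (psl A) = coords g A"
  by (simp add: X_chart_def inv_into_f_f[OF inj_on_psl_Y_chart])

lemma openin_X_chart:
  "openin (subtopology PSL2_topology (X_tau (pm t))) (psl ` Y_chart t g)"
  using open_map_psl_Y_t openin_Y_chart by (auto simp: open_map_def)

text \<open>On the chart domain \<open>psl\<close> is continuous, open and injective, so it has a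
  continuous inverse; the chart is this inverse followed by \<open>coords\<close>.\<close>

lemma homeomorphic_map_X_chart:
  assumes g: "det g = 1"
  shows "homeomorphic_map (subtopology PSL2_topology (psl ` Y_chart t g)) (top_of_set half_space) (X_chart t g)"
proof -
  let ?X = "subtopology PSL2_topology (X_tau (pm t))" and ?D = "Y_chart t g"
  have sub: "?D \<subseteq> Y_t t" by (auto simp: Y_chart_def)
  then have XU: "subtopology PSL2_topology (psl ` ?D) = subtopology ?X (psl ` ?D)"
    by (simp add: subtopology_subtopology X_tau_eq inf_absorb2 image_mono)
  have YD: "top_of_set ?D = subtopology (top_of_set (Y_t t)) ?D"
    using sub by (simp add: subtopology_subtopology inf_absorb2)
  have psl: "homeomorphic_map (top_of_set ?D) (subtopology ?X (psl ` ?D)) psl"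
  proof (rule bijective_open_imp_homeomorphic_map)
    show "continuous_map (top_of_set ?D) (subtopology ?X (psl ` ?D)) psl"
      unfolding YD
      by (intro continuous_map_into_subtopology continuous_map_from_subtopology[OF continuous_map_psl_Y_t])
        auto
    show "open_map (top_of_set ?D) (subtopology ?X (psl ` ?D)) psl"
      unfolding YD
      by (intro open_map_into_subtopology open_map_from_subtopology[OF open_map_psl_Y_t openin_Y_chart])
        auto
    show "psl ` topspace (top_of_set ?D) = topspace (subtopology ?X (psl ` ?D))"
      using sub X_tau_subset[of t] by (auto simp: X_tau_eq)
    show "inj_on psl (topspace (top_of_set ?D))"
      using inj_on_psl_Y_chart by simp
  qed
  then obtain h where h: "homeomorphic_maps (top_of_set ?D) (subtopology ?X (psl ` ?D)) psl h"
    by (auto simp: homeomorphic_map_maps)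
  then have "homeomorphic_maps (subtopology ?X (psl ` ?D)) (top_of_set ?D) h psl"
    by (subst homeomorphic_maps_sym)
  then have "homeomorphic_map (subtopology ?X (psl ` ?D)) (top_of_set half_space) (coords g \<circ> h)"
    using homeomorphic_maps_coords[OF g] by (intro homeomorphic_map_compose homeomorphic_maps_imp_map)
  moreover have "(coords g \<circ> h) x = X_chart t g x" if x: "x \<in> topspace (subtopology ?X (psl ` ?D))" for x
  proof -
    obtain A where "A \<in> ?D" "x = psl A" using x by auto
    then show ?thesis using h by (simp add: homeomorphic_maps_def X_chart_psl)
  qed
  ultimately show ?thesis unfolding XU by (rule homeomorphic_map_eq)
qed

lemma X_chart_image: "det g = 1 \<Longrightarrow> X_chart t g ` psl ` Y_chart t g = half_space"
  using X_chart_psl[of _ t g] coords_in_half_space[of _ t g] coords_param[of g t] param_in_Y_chart[of g _ t]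
  by (auto simp: image_image image_iff intro!: bexI[of _ "param t g _"])

lemma inv_into_X_chart:
  assumes g: "det g = 1" and v: "v \<in> half_space"
  shows "inv_into (psl ` Y_chart t g) (X_chart t g) v = psl (param t g v)"
proof (rule inv_into_f_eq)
  show "inj_on (X_chart t g) (psl ` Y_chart t g)"
    by (rule inj_on_inverseI[where g = "psl \<circ> param t g"]) (auto simp: X_chart_psl param_coords[OF g])
qed (use assms in \<open>auto simp: X_chart_psl param_in_Y_chart coords_param\<close>)

section \<open>Transition maps\<close>

lemma complex_diff_conj_param:
  assumes "v$2 \<noteq> 0"
  shows "complex_diff_at (\<lambda>v. (h ** param t g v ** adj2 h)$i$j) v"
proof -
  have "complex_diff_at (\<lambda>v. mat2 (v$1) (v$2) ((v$1 * (t - v$1) - 1) / v$2) (t - v$1) $ i $ j) v"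
    for i j
  proof -
    have "\<forall>i j. complex_diff_at (\<lambda>v. mat2 (v$1) (v$2) ((v$1 * (t - v$1) - 1) / v$2) (t - v$1) $ i $ j) v"
      unfolding forall_2 mat2_nth using assms
      by (intro conjI complex_diff_component complex_diff_divide complex_diff_diff complex_diff_mult
          complex_diff_const)
    then show ?thesis by blast
  qed
  then show ?thesis
    unfolding param_def by (intro complex_diff_matrix_mult complex_diff_const)
qed

lemma conj_scaleR:
  "g ** (s *\<^sub>R A) ** h = s *\<^sub>R (g ** A ** h)" for A :: "complex^2^2"
  by (simp add: vec_eq_iff matrix_matrix_mult_def sum_2 algebra_simps)

text \<open>The two charts may lift a class to opposite matrices. The sign s relating the lifts is
  constant near a given point, and with s fixed the transition map is rational with denominator
  \<open>v$2\<close>.\<close>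

lemma holomorphic_transition:
  assumes g: "det g = 1" and h: "det h = 1"
  shows "holomorphic_vec_on (X_chart t h \<circ> inv_into (psl ` Y_chart t g) (X_chart t g))
    (X_chart t g ` (psl ` Y_chart t g \<inter> psl ` Y_chart t h))"
  unfolding holomorphic_vec_on_def
proof
  let ?T = "X_chart t h \<circ> inv_into (psl ` Y_chart t g) (X_chart t g)"
  fix v assume "v \<in> X_chart t g ` (psl ` Y_chart t g \<inter> psl ` Y_chart t h)"
  then obtain A B where A: "A \<in> Y_chart t g" "v = X_chart t g (psl A)"
    and B: "B \<in> Y_chart t h" "psl A = psl B" by blast
  have v: "v \<in> half_space" "param t g v = A"
    using A param_coords[OF g] by (auto simp: X_chart_psl coords_in_half_space)
  obtain s :: real where s: "s = 1 \<or> s = - 1" "B = s *\<^sub>R A"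
  proof -
    have "B = A \<or> B = - A" using B(2) psl_eq_iff by metis
    then show thesis using that[of 1] that[of "- 1"] by auto
  qed
  have psl_s: "psl (s *\<^sub>R C) = psl C" for C using s(1) by (auto simp: psl_uminus)
  \<comment> \<open>Opposite lifts have opposite traces, so both lie in \<open>Y_t t\<close> only
    for t = 0; hence multiplication by s preserves \<open>Y_t t\<close>.\<close>
  have st: "s = 1 \<or> t = 0"
    using s A(1) B(1) by (auto simp: Y_chart_def Y_t_def trace_uminus)
  \<comment> \<open>The open neighbourhood of v on which s times the g-lift satisfies the positivity
    condition of the h-chart, hence is its lift.\<close>
  define W where "W = half_space \<inter> {w. Re (s *\<^sub>R (h ** param t g w ** adj2 h)$1$2) > 0}"
  have TW: "?T w = vector [of_real s * (h ** param t g w ** adj2 h)$1$1,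
      of_real s * (h ** param t g w ** adj2 h)$1$2]" if w: "w \<in> W" for w
  proof -
    have "param t g w \<in> Y_t t" using param_in_Y_chart[OF g] w by (auto simp: W_def Y_chart_def)
    then have "s *\<^sub>R param t g w \<in> Y_t t"
      using s(1) st uminus_in_Y_t[of "param t g w" t] by auto
    then have "s *\<^sub>R param t g w \<in> Y_chart t h"
      using w by (simp add: Y_chart_def W_def conj_scaleR)
    then have "X_chart t h (psl (param t g w)) = coords h (s *\<^sub>R param t g w)"
      using X_chart_psl psl_s by metis
    then show ?thesis
      using inv_into_X_chart[OF g] w by (simp add: W_def coords_def conj_scaleR scaleR_conv_of_real[where 'a = complex])
  qed
  have "continuous_on half_space (\<lambda>w. Re (s *\<^sub>R (h ** param t g w ** adj2 h)$1$2))"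
    using homeomorphic_maps_coords[OF g, of t] unfolding homeomorphic_maps_def
    by (intro continuous_intros) auto
  then have "open W"
    using continuous_open_preimage[OF _ open_half_space open_greaterThan[of 0]]
    by (simp add: W_def vimage_def Int_def)
  moreover have "v \<in> W"
    using v B(1) s(2) by (simp add: W_def Y_chart_def conj_scaleR)
  moreover have "v$2 \<noteq> 0" using v(1) by (auto simp: half_space_def)
  then obtain D where D: "((\<lambda>w. vector [of_real s * (h ** param t g w ** adj2 h)$1$1,
      of_real s * (h ** param t g w ** adj2 h)$1$2] :: complex^2) has_derivative D) (at v)"
    "\<forall>c u. D (c *s u) = c *s D u"
    using complex_diff_vector[OF complex_diff_mult[OF complex_diff_const complex_diff_conj_param]
      complex_diff_mult[OF complex_diff_const complex_diff_conj_param]] by blast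
  ultimately have "(?T has_derivative D) (at v)"
    using has_derivative_transform_within_open[OF D(1) \<open>open W\<close> \<open>v \<in> W\<close>, of ?T] TW by auto
  then show "\<exists>D. (?T has_derivative D) (at v) \<and> (\<forall>c u. D (c *s u) = c *s D u)"
    using D(2) by blast
qed

text \<open>There is one chart for each g in \<open>SL2\<close>. Second countability is inherited
  from the matrices through the open map \<open>psl\<close>, and the Hausdorff property from
  \<open>PSL2\<close>.\<close>

lemma complex_manifold_X_tau:
  "complex_manifold TYPE(2) (subtopology PSL2_topology (X_tau (pm t)))"
  unfolding complex_manifold_def
proof (intro conjI exI)
  let ?X = "subtopology PSL2_topology (X_tau (pm t))"
  let ?A = "(\<lambda>g. (psl ` Y_chart t g, X_chart t g)) ` carrier SL2"
  show "Hausdorff_space ?X" using Hausdorff_PSL2 by (rule Hausdorff_space_subtopology)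
  show "second_countable ?X" by (rule second_countable_X_tau)
  have sub: "psl ` Y_chart t g \<subseteq> X_tau (pm t)" for g
    by (auto simp: Y_chart_def X_tau_eq)
  have "(\<Union>(U, \<phi>)\<in>?A. U) = X_tau (pm t)"
  proof
    show "X_tau (pm t) \<subseteq> (\<Union>(U, \<phi>)\<in>?A. U)"
    proof
      fix x assume "x \<in> X_tau (pm t)"
      then obtain A where A: "A \<in> Y_t t" "x = psl A" by (auto simp: X_tau_eq)
      obtain g where "det g = 1" "A \<in> Y_chart t g" using A(1) by (rule Y_chart_cover)
      then show "x \<in> (\<Union>(U, \<phi>)\<in>?A. U)" using A(2) by auto
    qed
  qed (use sub in auto)
  moreover have "subtopology ?X (psl ` Y_chart t g) = subtopology PSL2_topology (psl ` Y_chart t g)" for g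
    using sub[of g] by (simp add: subtopology_subtopology inf_absorb2)
  ultimately show "complex_atlas ?X ?A"
    using openin_X_chart[of t] homeomorphic_map_X_chart[of _ t] holomorphic_transition[of _ _ t] topspace_X_tau[of t]
    by (auto simp: complex_atlas_def X_chart_image open_half_space simp del: topspace_subtopology)
qed

section \<open>The connected components of \<open>Conj PSL2\<close>\<close>

lemma \<T>_cases:
  assumes "\<tau> \<in> \<T>"
  obtains t where "\<tau> = pm t"
  using assms by (auto simp: \<T>_def)

lemma one_notin_X_tau: "\<one>\<^bsub>PSL2\<^esub> \<notin> X_tau \<tau>"
  by (auto simp: X_tau_def)

lemma X_tau_nonempty: "X_tau (pm t) \<noteq> {}"
  using companion_in_Y_t[of t] by (auto simp: X_tau_eq)

lemma carrier_PSL2_decomposition: "carrier PSL2 = {\<one>\<^bsub>PSL2\<^esub>} \<union> (\<Union>\<tau>\<in>\<T>. X_tau \<tau>)"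
proof
  show "{\<one>\<^bsub>PSL2\<^esub>} \<union> (\<Union>\<tau>\<in>\<T>. X_tau \<tau>) \<subseteq> carrier PSL2"
    using X_tau_subset by (auto elim!: \<T>_cases)
  show "carrier PSL2 \<subseteq> {\<one>\<^bsub>PSL2\<^esub>} \<union> (\<Union>\<tau>\<in>\<T>. X_tau \<tau>)"
  proof
    fix x assume "x \<in> carrier PSL2"
    then obtain A where A: "det A = 1" "x = psl A" by (rule psl_cases)
    have "pm (trace A) \<in> \<T>" by (simp add: \<T>_def)
    moreover have "x \<in> X_tau (pm (trace A))" if "x \<noteq> \<one>\<^bsub>PSL2\<^esub>"
      using A that by (auto simp: X_tau_def pm_def)
    ultimately show "x \<in> {\<one>\<^bsub>PSL2\<^esub>} \<union> (\<Union>\<tau>\<in>\<T>. X_tau \<tau>)" by blast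
  qed
qed

lemma disjoint_X_tau: "disjoint_family_on X_tau \<T>"
proof -
  have *: "pm t = pm u" if x: "x \<in> X_tau (pm t)" "x \<in> X_tau (pm u)" for x t u
  proof -
    obtain A B where A: "A \<in> Y_t t" "x = psl A" and B: "B \<in> Y_t u" "x = psl B"
      using x unfolding X_tau_eq by blast
    have "A = B \<or> A = - B" using A(2) B(2) psl_eq_iff by metis
    then show ?thesis using A(1) B(1) by (auto simp: Y_t_def pm_eq_iff trace_uminus)
  qed
  have "X_tau \<sigma> \<inter> X_tau \<tau> = {}" if "\<sigma> \<in> \<T>" "\<tau> \<in> \<T>" "\<sigma> \<noteq> \<tau>" for \<sigma> \<tau>
    using that * by (blast elim!: \<T>_cases)
  then show ?thesis by (simp add: disjoint_family_on_def)
qed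

lemma quandle_components_PSL2:
  "quandle_components (Conj PSL2) = {{\<one>\<^bsub>PSL2\<^esub>}} \<union> X_tau ` \<T>"
proof -
  have one: "conj_class PSL2 \<one>\<^bsub>PSL2\<^esub> = {\<one>\<^bsub>PSL2\<^esub>}"
    using PSL2.conj_class_self[OF PSL2.one_closed] by (auto simp: conj_class_def)
  have X: "conj_class PSL2 x = X_tau \<tau>" if "\<tau> \<in> \<T>" "x \<in> X_tau \<tau>" for x \<tau>
    using that X_tau_conj_class by (auto elim!: \<T>_cases)
  have "conj_class PSL2 ` X_tau \<tau> = {X_tau \<tau>}" if "\<tau> \<in> \<T>" for \<tau>
  proof -
    \<comment> \<open>An empty set would contribute no orbit at all, so its image would not be a
      singleton.\<close>
    have "X_tau \<tau> \<noteq> {}" using that X_tau_nonempty by (auto elim!: \<T>_cases)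
    then show ?thesis using X[OF that] by auto
  qed
  then have "conj_class PSL2 ` carrier PSL2 = {{\<one>\<^bsub>PSL2\<^esub>}} \<union> X_tau ` \<T>"
    unfolding carrier_PSL2_decomposition image_Un image_UN by (simp add: one UNION_singleton_eq_range)
  then show ?thesis by (simp add: PSL2.quandle_components_Conj)
qed

theorem theorem5p6:
  fixes rep l :: "complex set \<Rightarrow> complex"
  assumes "\<And>\<tau>. \<tau> \<in> \<T> \<Longrightarrow> \<tau> \<noteq> pm 2 \<Longrightarrow> rep \<tau> \<in> \<tau> \<and> is_lambda (rep \<tau>) (l \<tau>)"
  shows "carrier (Conj PSL2) = {\<one>\<^bsub>PSL2\<^esub>} \<union> (\<Union>\<tau>\<in>\<T>. X_tau \<tau>) \<and>
    (\<forall>\<tau>\<in>\<T>. \<one>\<^bsub>PSL2\<^esub> \<notin> X_tau \<tau>) \<and>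
    disjoint_family_on X_tau \<T> \<and>
    quandle_components (Conj PSL2) = {{\<one>\<^bsub>PSL2\<^esub>}} \<union> X_tau ` \<T> \<and>
    (\<forall>\<tau>\<in>\<T>.
      complex_manifold TYPE(2) (subtopology PSL2_topology (X_tau \<tau>)) \<and>
      subtopology PSL2_topology (X_tau \<tau>) homeomorphic_space coset_topology (H_tau \<tau>) \<and>
      subquandle (X_tau \<tau>) (Conj PSL2) \<and>
      connected_quandle (Conj_on PSL2 (X_tau \<tau>)) \<and>
      quandle_triplet PSL2 (H_tau \<tau>) (sigma_tau l \<tau>) \<and>
      quandle_isomorphic (Conj_on PSL2 (X_tau \<tau>)) (triplet_quandle PSL2 (H_tau \<tau>) (sigma_tau l \<tau>)))"
proof (intro conjI ballI)
  show "carrier (Conj PSL2) = {\<one>\<^bsub>PSL2\<^esub>} \<union> (\<Union>\<tau>\<in>\<T>. X_tau \<tau>)"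
    using carrier_PSL2_decomposition by (simp add: Conj_on_def)
  show "disjoint_family_on X_tau \<T>" by (rule disjoint_X_tau)
  show "quandle_components (Conj PSL2) = {{\<one>\<^bsub>PSL2\<^esub>}} \<union> X_tau ` \<T>"
    by (rule quandle_components_PSL2)
  fix \<tau> assume \<tau>: "\<tau> \<in> \<T>"
  then obtain t where t: "\<tau> = pm t" by (rule \<T>_cases)
  show "\<one>\<^bsub>PSL2\<^esub> \<notin> X_tau \<tau>" by (rule one_notin_X_tau)
  show "complex_manifold TYPE(2) (subtopology PSL2_topology (X_tau \<tau>))"
    unfolding t by (rule complex_manifold_X_tau)
  define f where "f = f_tau l \<tau>"
  \<comment> \<open>With f as base point, the class is an orbit, \<open>H_tau\<close> its stabilizer
    and \<open>sigma_tau\<close> the inner automorphism of f; the remaining claims become statements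
    about an arbitrary element of the class.\<close>
  have f: "f \<in> X_tau \<tau>" "H_tau \<tau> = centralizer PSL2 f"
    unfolding f_def using f_tau_in_X_tau[of \<tau> "rep \<tau>" l] centralizer_f_tau[of \<tau> "rep \<tau>" l] \<tau> assms[OF \<tau>]
    by simp_all
  have fc: "f \<in> carrier PSL2" using f(1) X_tau_subset unfolding t by blast
  have X: "X_tau \<tau> = conj_class PSL2 f" using f(1) unfolding t by (rule X_tau_conj_class)
  have sigma: "sigma_tau l \<tau> = (\<lambda>g. inv\<^bsub>PSL2\<^esub> f \<otimes>\<^bsub>PSL2\<^esub> g \<otimes>\<^bsub>PSL2\<^esub> f)"
    by (simp add: sigma_tau_def f_def fun_eq_iff)
  show "subtopology PSL2_topology (X_tau \<tau>) homeomorphic_space coset_topology (H_tau \<tau>)"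
    using f(1) unfolding f(2) unfolding t by (rule X_tau_homeomorphic_cosets)
  show conn: "connected_quandle (Conj_on PSL2 (X_tau \<tau>))"
    unfolding X using fc
  proof (rule PSL2.connected_quandle_conj_class)
    show "generate PSL2 (conj_class PSL2 f) = carrier PSL2"
      unfolding X[symmetric] t by (rule generate_X_tau)
  qed
  then have "quandle (Conj_on PSL2 (X_tau \<tau>))" by (simp add: connected_quandle_def)
  then show "subquandle (X_tau \<tau>) (Conj PSL2)"
    using X_tau_subset[of t] by (simp add: subquandle_def Conj_on_def t)
  show "quandle_triplet PSL2 (H_tau \<tau>) (sigma_tau l \<tau>)"
    unfolding f(2) sigma using fc by (rule PSL2.quandle_triplet_centralizer)
  show "quandle_isomorphic (Conj_on PSL2 (X_tau \<tau>))
      (triplet_quandle PSL2 (H_tau \<tau>) (sigma_tau l \<tau>))"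
    unfolding f(2) sigma X using fc by (rule PSL2.conj_class_isomorphic_triplet_quandle)
qed

end
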